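(* For every (fixed) real number $c>0$ we have $$e_c(t) = \frac{(2\pi)^{(c-1)/2}}{\sqrt{c}}\,\frac{\exp(-c\,t^{1/c})}{t^{(c-1)/(2c)}}\left[1+\mathcal O\!\left(\frac{1}{t^{1/c}}\right)\right],\qquad t\to\infty.$$
   Context: For $c>0$ the function $e_c:(0,\infty)\to\mathbb R$ is defined by $$e_c(t)=\frac{1}{2\pi}\int_{-\infty}^{\infty} t^{ix-1}\,\Gamma(1-ix)^c\,dx,\qquad t>0,$$ where $\Gamma(z)^c=\exp(c\log\Gamma(z))$ for $z\in\mathbb C\setminus(-\infty,0]$, and $\log\Gamma$ denotes the holomorphic branch on $\mathbb C\setminus(-\infty,0]$ of the logarithm of the (non-vanishing) function $\Gamma$ that equals $0$ at $z=1$. It is known that $e_c$ is a probability density on $(0,\infty)$. *)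

theory Defs
  imports "HOL-Analysis.Analysis" "HOL-Library.Landau_Symbols"
begin

text \<open>
  The library's complex \<^const>\<open>ln_Gamma\<close> is the limit of
  \<open>z * ln n - ln z - (\<Sum>k=1..n. ln (z / k + 1))\<close>. The following lemmas show that on the plane slit along
  the non-positive reals it is the holomorphic logarithm of \<^const>\<open>Gamma\<close> that vanishes at \<open>1\<close>, and
  that it is the only one.
\<close>

lemma ln_Gamma_branch:
  shows "ln_Gamma holomorphic_on (- \<real>\<^sub>\<le>\<^sub>0)"
    and "z \<notin> \<real>\<^sub>\<le>\<^sub>0 \<Longrightarrow> exp (ln_Gamma z) = Gamma (z :: complex)"
    and "ln_Gamma (1 :: complex) = 0"
proof -
  show "ln_Gamma holomorphic_on (- \<real>\<^sub>\<le>\<^sub>0)"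
    by (rule holomorphic_ln_Gamma) auto
  show "exp (ln_Gamma z) = Gamma z" if "z \<notin> \<real>\<^sub>\<le>\<^sub>0"
    using that nonpos_Ints_subset_nonpos_Reals by (subst Gamma_complex_altdef) auto
  show "ln_Gamma (1 :: complex) = 0"
    using ln_Gamma_complex_conv_fact[of 1] by simp
qed

lemma ln_Gamma_branch_unique:
  assumes f: "f holomorphic_on (- \<real>\<^sub>\<le>\<^sub>0)"
    and exp_f: "\<And>z. z \<notin> \<real>\<^sub>\<le>\<^sub>0 \<Longrightarrow> exp (f z) = Gamma (z :: complex)"
    and f1: "f 1 = 0"
    and z: "z \<notin> \<real>\<^sub>\<le>\<^sub>0"
  shows "f z = ln_Gamma z"
proof -
  define S where "S = (- \<real>\<^sub>\<le>\<^sub>0 :: complex set)"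
  define h where "h = (\<lambda>w. (f w - ln_Gamma w) / (2 * of_real pi * \<i>))"
  have cont: "continuous_on S h"
    unfolding h_def S_def
    using holomorphic_on_imp_continuous_on[OF f]
      holomorphic_on_imp_continuous_on[OF ln_Gamma_branch(1)]
    by (intro continuous_intros) auto
  have int: "h w \<in> \<int>" if "w \<in> S" for w
  proof -
    have "exp (f w) = exp (ln_Gamma w)"
      using that exp_f ln_Gamma_branch(2) by (auto simp: S_def)
    then obtain n :: int where "f w = ln_Gamma w + of_real (real_of_int (2 * n) * pi) * \<i>"
      unfolding exp_eq by blast
    hence "h w = of_int n" by (simp add: h_def)
    thus ?thesis by simp
  qed
  have "(\<real>\<^sub>\<le>\<^sub>0 :: complex set) = complex_of_real ` {..0}"
    by (auto simp: nonpos_Reals_def)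
  then have conn: "connected S"
    unfolding S_def using starlike_imp_connected starlike_slotted_complex_plane_left[of 0] by metis
  have "h constant_on S"
  proof (rule continuous_discrete_range_constant[OF conn cont])
    show "\<exists>e>0. \<forall>y. y \<in> S \<and> h y \<noteq> h x \<longrightarrow> e \<le> norm (h y - h x)" if "x \<in> S" for x
    proof (intro exI[of _ 1] conjI allI impI)
      fix y assume y: "y \<in> S \<and> h y \<noteq> h x"
      obtain m n where mn: "h y = of_int m" "h x = of_int n"
        using int[of x] \<open>x \<in> S\<close> int[of y] y by (auto elim!: Ints_cases)
      with y have "m \<noteq> n" by auto
      then show "1 \<le> norm (h y - h x)"
        unfolding mn of_int_diff[symmetric] norm_of_int by linarith
    qed simp
  qed
  moreover have "z \<in> S" "1 \<in> S"
    using z by (auto simp: S_def complex_nonpos_Reals_iff)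
  ultimately have "h z = h 1"
    by (auto simp: constant_on_def)
  thus ?thesis
    by (simp add: h_def f1 ln_Gamma_branch(3))
qed

lemma cnj_ln_Gamma:
  assumes z: "z \<notin> \<real>\<^sub>\<le>\<^sub>0"
  shows "cnj (ln_Gamma z) = ln_Gamma (cnj z)"
proof -
  have z': "cnj z \<notin> \<real>\<^sub>\<le>\<^sub>0" using z by (simp add: complex_nonpos_Reals_iff)
  have "cnj (ln_Gamma_series z n) = ln_Gamma_series (cnj z) n" if "n > 0" for n
  proof -
    have "cnj (ln (z / of_nat k + 1)) = ln (cnj z / of_nat k + 1)" if "k \<in> {1..n}" for k
    proof -
      have "z / of_nat k + 1 \<notin> \<real>\<^sub>\<le>\<^sub>0"
        using z that by (auto simp: complex_nonpos_Reals_iff field_simps)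
      thus ?thesis by (subst cnj_Ln) simp_all
    qed
    moreover have "cnj (ln (of_nat n :: complex)) = ln (of_nat n)"
      using that by (simp add: cnj_Ln)
    moreover have "cnj (ln z) = ln (cnj z)" using z by (rule cnj_Ln)
    ultimately show ?thesis by (simp add: ln_Gamma_series_def)
  qed
  moreover have "(\<lambda>n. cnj (ln_Gamma_series z (Suc n))) \<longlonglongrightarrow> cnj (ln_Gamma z)"
    using z nonpos_Ints_subset_nonpos_Reals by (intro tendsto_cnj LIMSEQ_Suc ln_Gamma_complex_LIMSEQ) auto
  moreover have "(\<lambda>n. ln_Gamma_series (cnj z) (Suc n)) \<longlonglongrightarrow> ln_Gamma (cnj z)"
    using z' nonpos_Ints_subset_nonpos_Reals by (intro LIMSEQ_Suc ln_Gamma_complex_LIMSEQ) auto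
  ultimately show ?thesis by (simp add: LIMSEQ_unique)
qed

definition Gamma_powr :: "complex \<Rightarrow> real \<Rightarrow> complex" where
  "Gamma_powr z c = exp (of_real c * ln_Gamma z)"

definition e_integral :: "real \<Rightarrow> real \<Rightarrow> complex" where
  "e_integral c t =
     1 / (2 * of_real pi) *
       (CLBINT x. of_real t powr (\<i> * of_real x - 1) * Gamma_powr (1 - \<i> * of_real x) c)"

text \<open>
  The integral is a real number, see \<open>e_dens_eq_integral\<close> below, so taking the real part only
  changes the type.
\<close>

definition e_dens :: "real \<Rightarrow> real \<Rightarrow> real" where
  "e_dens c t = Re (e_integral c t)"

lemma e_dens_eq_integral:
  assumes "t > 0"
  shows "complex_of_real (e_dens c t) = e_integral c t"
proof -
  define F where
    "F = (\<lambda>x::real. complex_of_real t powr (\<i> * of_real x - 1) * Gamma_powr (1 - \<i> * of_real x) c)"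
  have cnj_F: "cnj (F x) = F (- x)" for x
  proof -
    have "1 - \<i> * of_real x \<notin> \<real>\<^sub>\<le>\<^sub>0"
      by (simp add: complex_nonpos_Reals_iff)
    then have "cnj (Gamma_powr (1 - \<i> * of_real x) c) = Gamma_powr (1 + \<i> * of_real x) c"
      by (simp add: Gamma_powr_def cnj_ln_Gamma exp_cnj)
    moreover have "cnj (complex_of_real t powr (\<i> * of_real x - 1)) = of_real t powr (- \<i> * of_real x - 1)"
      using assms by (simp add: powr_def Ln_of_real exp_cnj)
    ultimately show ?thesis by (simp add: F_def)
  qed
  have "cnj (integral\<^sup>L lborel F) = (\<integral>x. F (- x) \<partial>lborel)"
    by (simp only: cnj_F flip: Bochner_Integration.integral_cnj)
  also have "\<dots> = integral\<^sup>L lborel F"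
    using lborel_integral_real_affine[of "-1" F 0] by simp
  finally have "cnj (e_integral c t) = e_integral c t"
    by (simp add: e_integral_def F_def)
  then have "Im (e_integral c t) = 0"
    by (simp add: complex_eq_iff)
  then show ?thesis
    by (simp add: e_dens_def complex_eq_iff)
qed

end

theory Submission
  imports Defs "HOL-Probability.Sinc_Integral" "HOL-Complex_Analysis.Cauchy_Integral_Theorem"
    "HOL-Real_Asymp.Real_Asymp"
begin

text \<open>
  Put \<open>s = t powr (1 / c)\<close>. The integral defining \<open>e_dens c t\<close> runs over the line \<open>Re z = 1\<close> and has integrand
  \<open>exp (c * (ln_Gamma z - z * ln s))\<close>, whose saddle point is close to \<open>z = s\<close>. The contour is moved to
  \<open>Re z = s\<close> and parametrised there by \<open>z = s * (1 + \<i> * v)\<close> with \<open>v = y / sqrt (c * s)\<close>. By Stirling's formula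
  with a remainder of size \<open>1 / s\<close>, the integrand is a constant times \<open>exp (- y\<^sup>2 / 2)\<close> times
  \<open>1 + (odd polynomial in y) / sqrt (c * s) + O (1 / s)\<close>. The odd part integrates to \<open>0\<close> against the
  Gaussian, so the relative error is \<open>1 / s\<close> rather than \<open>1 / sqrt s\<close>. The error estimates are integrable
  uniformly in \<open>s\<close> because \<open>c * s * Re ((1 + \<i> * v) * Ln (1 + \<i> * v) - \<i> * v)\<close> is at most
  \<open>- y\<^sup>2 / (2 * (1 + \<bar>y\<bar>))\<close> as soon as \<open>c * s \<ge> 1\<close>.
\<close>

subsection \<open>Stirling's formula in the right half-plane\<close>

lemma Re_nonneg_imp_one_plus:
  fixes u :: complex
  assumes "Re u \<ge> 0"
  shows "1 + u \<notin> \<real>\<^sub>\<le>\<^sub>0" "1 + u \<noteq> 0" "cmod (1 + u) \<ge> 1"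
proof -
  show "1 + u \<notin> \<real>\<^sub>\<le>\<^sub>0" using assms by (auto simp: complex_nonpos_Reals_iff)
  thus "1 + u \<noteq> 0" by auto
  show "cmod (1 + u) \<ge> 1" using complex_Re_le_cmod[of "1+u"] assms by simp
qed

text \<open>The factor \<open>1 + u / 2\<close> is chosen so that the Taylor coefficients at 0 of
  orders 0, 1 and 2 all vanish. The third derivative \<open>(1 - u) / (2 * (1 + u) ^ 3)\<close> is
  at most 1/2 in modulus, because |1 - u| <= |1 + u| and 1 <= |1 + u| on the right
  half-plane.\<close>

lemma Ln_half_step_Taylor_bound:
  fixes u :: complex
  assumes u: "Re u \<ge> 0"
  shows "cmod ((1 + u / 2) * Ln (1 + u) - u) \<le> cmod u ^ 3 / 4"
proof -
  define S where "S = {z. Re z \<ge> 0}"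
  define f :: "nat \<Rightarrow> complex \<Rightarrow> complex" where
    "f = (\<lambda>i u. if i = 0 then (1 + u / 2) * Ln (1 + u) - u
       else if i = 1 then Ln (1 + u) / 2 + inverse (1 + u) / 2 - 1 / 2
       else if i = 2 then u / (2 * (1 + u)^2)
       else (1 - u) / (2 * (1 + u) ^ 3))"
  have f0: "f 0 = (\<lambda>u. (1 + u / 2) * Ln (1 + u) - u)"
    and f1: "f (Suc 0) = (\<lambda>u. Ln (1 + u) / 2 + inverse (1 + u) / 2 - 1 / 2)"
    and f2: "f (Suc (Suc 0)) = (\<lambda>u. u / (2 * (1 + u)^2))"
    and f3: "f (Suc (Suc (Suc 0))) = (\<lambda>u. (1 - u) / (2 * (1 + u) ^ 3))"
    by (simp_all add: f_def fun_eq_iff)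
  have "cmod (f 0 u - (\<Sum>i\<le>2. f i 0 * (u - 0) ^ i / (fact i)))
          \<le> 1 / 2 * cmod (u - 0) ^ Suc 2 / fact 2"
  proof (rule complex_Taylor[where S = S])
    show "convex S" unfolding S_def by (rule convex_halfspace_Re_ge)
    show "0 \<in> S" "u \<in> S" using u by (auto simp: S_def)
    show "cmod (f (Suc 2) x) \<le> 1 / 2" if "x \<in> S" for x
    proof -
      have x: "Re x \<ge> 0" using that by (simp add: S_def)
      have "cmod (1 - x) \<le> cmod (1 + x)"
        using x by (auto simp: cmod_def power2_eq_square algebra_simps)
      also have "\<dots> \<le> cmod (1 + x) ^ 3"
        using power_increasing[of 1 3 "cmod (1+x)"] Re_nonneg_imp_one_plus(3)[OF x] by simp
      finally show ?thesis
        using Re_nonneg_imp_one_plus(2,3)[OF x]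
        by (simp add: f3 norm_divide norm_mult norm_power divide_simps numeral_2_eq_2)
    qed
    show "(f i has_field_derivative f (Suc i) x) (at x within S)" if "x \<in> S" "i \<le> 2" for i x
    proof -
      have x: "Re x \<ge> 0" using that by (simp add: S_def)
      note nz = Re_nonneg_imp_one_plus(1,2)[OF x]
      consider "i = 0" | "i = Suc 0" | "i = Suc (Suc 0)" using \<open>i \<le> 2\<close> by linarith
      thus ?thesis
      proof cases
        case 1
        have "(f 0 has_field_derivative
                 Ln (1 + x) / 2 + inverse (1 + x) * (1 + x / 2) - 1) (at x within S)"
          unfolding f0 using nz by (auto intro!: derivative_eq_intros)
        also have "Ln (1 + x) / 2 + inverse (1 + x) * (1 + x / 2) - 1 = f (Suc 0) x"
        proof -
          have "y * (1 + x / 2) = y * (1 + x) / 2 + y / 2" for y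
            by (simp add: field_simps)
          hence "inverse (1 + x) * (1 + x / 2) = 1 / 2 + inverse (1 + x) / 2"
            using nz(2) by simp
          thus ?thesis by (simp add: f1)
        qed
        finally show ?thesis unfolding 1 .
      next
        case 2
        have "(f (Suc 0) has_field_derivative
                 inverse (1 + x) / 2 - inverse (1 + x) * inverse (1 + x) / 2) (at x within S)"
          unfolding f1 using nz by (auto intro!: derivative_eq_intros)
        also have "inverse (1 + x) / 2 - inverse (1 + x) * inverse (1 + x) / 2 = f (Suc (Suc 0)) x"
        proof -
          have "x * inverse (1 + x) = 1 - inverse (1 + x)"
            using nz(2) by (simp add: field_simps)
          hence "inverse (1 + x) / 2 - inverse (1 + x) * inverse (1 + x) / 2 =
                   (x * inverse (1 + x)) * inverse (1 + x) / 2"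
            by (simp only: left_diff_distrib diff_divide_distrib mult_1_left)
          also have "w \<noteq> 0 \<Longrightarrow> (x * inverse w) * inverse w / 2 = x / (2 * w\<^sup>2)" for w
            by (simp add: field_simps power2_eq_square)
          finally show ?thesis using nz(2) by (simp add: f2)
        qed
        finally show ?thesis unfolding 2 .
      next
        case 3
        show ?thesis unfolding 3 f2 f3 using nz
          by (auto intro!: derivative_eq_intros simp: divide_simps power2_eq_square)
             (auto simp: algebra_simps power3_eq_cube power2_eq_square power4_eq_xxxx)
      qed
    qed
  qed
  also have "(\<Sum>i\<le>2. f i 0 * (u - 0) ^ i / (fact i)) = 0"
    by (simp add: f_def numeral_2_eq_2)
  finally show ?thesis by (simp add: f0)
qed

text \<open>With g(w) = (w - 1/2) Ln w - w this is g(w + 1) - g(w) - Ln w, the defect of Stirling's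
  main term in the functional equation of \<open>ln_Gamma\<close>.\<close>

definition Stirling_term :: "complex \<Rightarrow> complex" where
  "Stirling_term w = (w + 1 / 2) * (Ln (w + 1) - Ln w) - 1"

text \<open>The factors \<open>w\<close> and \<open>1 + 1 / w\<close> lie in the right half-plane,
  so their arguments add up without leaving the principal range.\<close>

lemma Ln_add_one:
  assumes "Re w > 0"
  shows "Ln (w + 1) = Ln w + Ln (1 + 1 / w)"
proof -
  have w0: "w \<noteq> 0" using assms by auto
  have r: "Re (1 / w) > 0"
    using assms by (auto simp: Re_divide sum_power2_gt_zero_iff intro!: divide_pos_pos)
  have "w + 1 = w * (1 + 1 / w)" using w0 by (simp add: field_simps)
  also have "Ln \<dots> = Ln w + Ln (1 + 1 / w)"
  proof (rule Ln_times_simple)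
    have "1 + 1 / w \<noteq> 0" using r by (metis Re_nonneg_imp_one_plus(2) less_imp_le)
    have "\<bar>Im (Ln w)\<bar> < pi / 2" "\<bar>Im (Ln (1 + 1 / w))\<bar> < pi / 2"
      using Re_Ln_pos_lt[of w] Re_Ln_pos_lt[of "1 + 1 / w"] assms r w0 \<open>1 + 1 / w \<noteq> 0\<close>
      by simp_all
    thus "- pi < Im (Ln w) + Im (Ln (1 + 1 / w))" "Im (Ln w) + Im (Ln (1 + 1 / w)) \<le> pi"
      by linarith+
    show "w \<noteq> 0" by fact
    show "1 + 1 / w \<noteq> 0" by fact
  qed
  finally show ?thesis .
qed

lemma Stirling_term_bound:
  assumes "Re w > 0"
  shows "cmod (Stirling_term w) \<le> 1 / (4 * cmod w ^ 2)"
proof -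
  have w0: "w \<noteq> 0" using assms by auto
  have r: "Re (1 / w) \<ge> 0"
    using assms by (auto simp: Re_divide intro!: divide_nonneg_nonneg)
  have "Stirling_term w = w * ((1 + (1 / w) / 2) * Ln (1 + 1 / w) - 1 / w)"
  proof -
    have "(w + 1 / 2) * L - 1 = w * ((1 + (1 / w) / 2) * L - 1 / w)" for L
      using w0 by (simp add: field_simps)
    thus ?thesis by (simp add: Stirling_term_def Ln_add_one[OF assms])
  qed
  also have "cmod \<dots> \<le> cmod w * (cmod (1 / w) ^ 3 / 4)"
    unfolding norm_mult by (intro mult_left_mono Ln_half_step_Taylor_bound r) auto
  also have "\<dots> = 1 / (4 * cmod w ^ 2)"
    using w0 by (simp add: norm_divide power_divide power3_eq_cube power2_eq_square field_simps)
  finally show ?thesis .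
qed

text \<open>For Re z > 0 the cross term in |z + n|^2 is nonnegative. The bound lets a real series in
  |z| + n dominate the complex one.\<close>

lemma norm_add_of_nat_ge:
  fixes z :: complex
  assumes "Re z > 0"
  shows "(cmod z + of_nat n)\<^sup>2 \<le> 2 * cmod (z + of_nat n) ^ 2"
proof -
  have "(cmod z + of_nat n)\<^sup>2 \<le> 2 * (cmod z ^ 2 + of_nat n ^ 2)"
    using zero_le_power2[of "cmod z - of_nat n"] by (simp add: power2_eq_square algebra_simps)
  also have "cmod z ^ 2 + of_nat n ^ 2 \<le> cmod (z + of_nat n) ^ 2"
    using assms by (simp add: cmod_power2) (simp add: power2_eq_square algebra_simps)
  finally show ?thesis by simp
qed

lemma telescope_inverse_sums:
  fixes a :: real
  assumes "a > 0"
  shows "(\<lambda>n. 1 / (a + n) - 1 / (a + Suc n)) sums (1 / a)"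
proof -
  have "(\<lambda>n. 1 / (a + real n) - 1 / (a + real (Suc n))) sums (1 / (a + real 0) - 0)"
    by (rule telescope_sums') real_asymp
  thus ?thesis by simp
qed

text \<open>The quadratic decay is traded for a telescoping majorant. The assumption |z| >= 1 enters
  as |z| + n + 1 <= 2 (|z| + n).\<close>

lemma Stirling_term_shift_bound:
  assumes "Re z > 0" "cmod z \<ge> 1"
  shows "cmod (Stirling_term (z + of_nat n)) \<le> 1 / (cmod z + n) - 1 / (cmod z + Suc n)"
proof -
  have "cmod (Stirling_term (z + of_nat n)) \<le> 1 / (4 * cmod (z + of_nat n) ^ 2)"
    using assms by (intro Stirling_term_bound) auto
  also have "\<dots> \<le> 1 / (2 * (cmod z + n)\<^sup>2)"
  proof -
    have "cmod z + n > 0" using assms by linarith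
    hence "(cmod z + n)\<^sup>2 > 0" by simp
    thus ?thesis using norm_add_of_nat_ge[of z n] assms(1) by (intro divide_left_mono mult_pos_pos) auto
  qed
  also have "\<dots> \<le> 1 / ((cmod z + n) * (cmod z + Suc n))"
  proof (intro divide_left_mono)
    have "(cmod z + n) * (cmod z + Suc n) \<le> (cmod z + n) * (2 * (cmod z + n))"
      using assms by (intro mult_left_mono) auto
    thus "(cmod z + n) * (cmod z + Suc n) \<le> 2 * (cmod z + n)\<^sup>2"
      by (simp only: power2_eq_square mult_ac)
  qed (use assms in auto)
  also have "\<dots> = 1 / (cmod z + n) - 1 / (cmod z + Suc n)"
    using assms by (simp add: field_simps add_eq_0_iff)
  finally show ?thesis .
qed

text \<open>Gudermann's series for Binet's function, the error term in Stirling's formula.\<close>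

definition Stirling_remainder :: "complex \<Rightarrow> complex" where
  "Stirling_remainder z = (\<Sum>n. Stirling_term (z + of_nat n))"

lemma summable_Stirling_term:
  assumes "Re z > 0" "cmod z \<ge> 1"
  shows "summable (\<lambda>n. cmod (Stirling_term (z + of_nat n)))"
  using Stirling_term_shift_bound[OF assms] telescope_inverse_sums[of "cmod z"] assms
  by (intro summable_comparison_test'[OF sums_summable[OF telescope_inverse_sums[of "cmod z"]]]) auto

lemma Stirling_remainder_bound:
  assumes "Re z > 0" "cmod z \<ge> 1"
  shows "cmod (Stirling_remainder z) \<le> 1 / cmod z"
proof -
  have "cmod (Stirling_remainder z) \<le> (\<Sum>n. cmod (Stirling_term (z + of_nat n)))"
    unfolding Stirling_remainder_def by (rule summable_norm[OF summable_Stirling_term[OF assms]])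
  also have "\<dots> \<le> (\<Sum>n. 1 / (cmod z + n) - 1 / (cmod z + Suc n))"
    using assms by (intro suminf_le Stirling_term_shift_bound summable_Stirling_term
        sums_summable[OF telescope_inverse_sums]) auto
  also have "\<dots> = 1 / cmod z"
    using assms by (intro sums_unique[symmetric] telescope_inverse_sums) auto
  finally show ?thesis .
qed

text \<open>The increments of (w - 1/2) Ln w - w telescope. Letting the last sum run up to
  \<open>n\<close> inclusive turns the coefficient z + n - 1/2 of the final logarithm into z + n +
  1/2.\<close>

lemma Stirling_term_partial_sum:
  "(\<Sum>k<n. Stirling_term (z + of_nat k)) =
     (z + of_nat n + 1 / 2) * Ln (z + of_nat n) - (z - 1 / 2) * Ln z - of_nat n - (\<Sum>k\<le>n. Ln (z + of_nat k))"
proof (induction n)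
  case (Suc n)
  have "z + of_nat n + 1 = z + of_nat (Suc n)" by simp
  thus ?case unfolding sum.lessThan_Suc Suc sum.atMost_Suc Stirling_term_def[of "z + of_nat n"]
    unfolding \<open>z + of_nat n + 1 = z + of_nat (Suc n)\<close> by (simp add: ring_distribs)
qed (simp add: algebra_simps)

lemma Ln_add_of_nat:
  assumes "Re z > 0" "n > 0"
  shows "Ln (z + of_nat n) = Ln (of_nat n) + Ln (z / of_nat n + 1)"
proof -
  have r: "Re (z / of_nat n) \<ge> 0" using assms by simp
  have "z + of_nat n = of_real (real n) * (z / of_nat n + 1)"
    using assms by (simp add: field_simps)
  also have "Ln \<dots> = of_real (ln (real n)) + Ln (z / of_nat n + 1)"
    using assms Re_nonneg_imp_one_plus(2)[OF r] by (subst Ln_times_of_real) (auto simp: add.commute)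
  finally show ?thesis using assms by simp
qed

text \<open>Four pieces are separated: the main term, partial sums of the remainder, a sequence free
  of \<open>z\<close>, and a last term that tends to \<open>z\<close>.\<close>

lemma ln_Gamma_series_eq_Stirling:
  assumes "Re z > 0" "n > 0"
  shows "ln_Gamma_series z n =
           (z - 1 / 2) * Ln z + (\<Sum>k<n. Stirling_term (z + of_nat k))
           + of_real (ln (fact n) - (n + 1 / 2) * ln n + n)
           - (z + of_nat n + 1 / 2) * Ln (1 + z / of_nat n)"
proof -
  have fact: "complex_of_real (ln (fact n)) = (\<Sum>k=1..n. Ln (of_nat k))"
  proof -
    have "ln (fact n) = (\<Sum>k=1..n. ln (real k))"
      unfolding fact_prod of_nat_prod by (subst ln_prod) auto
    thus ?thesis by (simp add: Ln_of_nat)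
  qed
  have "(\<Sum>k\<le>n. Ln (z + of_nat k)) = Ln z + (\<Sum>k=1..n. Ln (z + of_nat k))"
    by (simp add: sum.atLeast_Suc_atMost flip: atLeast0AtMost)
  also have "(\<Sum>k=1..n. Ln (z + of_nat k)) = (\<Sum>k=1..n. Ln (of_nat k) + Ln (z / of_nat k + 1))"
    using assms by (intro sum.cong refl Ln_add_of_nat) auto
  also have "\<dots> = complex_of_real (ln (fact n)) + (\<Sum>k=1..n. Ln (z / of_nat k + 1))"
    by (simp add: sum.distrib fact)
  finally have *: "(\<Sum>k=1..n. Ln (z / of_nat k + 1)) =
      (\<Sum>k\<le>n. Ln (z + of_nat k)) - Ln z - complex_of_real (ln (fact n))" by simp
  have Ln_n: "Ln (of_nat n) = complex_of_real (ln n)" using assms by (simp add: Ln_of_nat)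
  show ?thesis
    unfolding ln_Gamma_series_def * Stirling_term_partial_sum Ln_add_of_nat[OF assms] Ln_n
    by (simp add: algebra_simps)
qed

lemma cmod_Ln_one_plus_le:
  assumes u: "Re u \<ge> 0"
  shows "cmod (Ln (1 + u)) \<le> cmod u" "cmod (Ln (1 + u) - u) \<le> cmod u ^ 2"
proof -
  define S where "S = {z. Re z \<ge> 0}"
  define f :: "nat \<Rightarrow> complex \<Rightarrow> complex" where
    "f = (\<lambda>i u. if i = 0 then Ln (1 + u) else if i = 1 then 1 / (1 + u) else - 1 / (1 + u)^2)"
  have f0: "f 0 = (\<lambda>u. Ln (1 + u))" and f1: "f (Suc 0) = (\<lambda>u. 1 / (1 + u))"
    and f2: "f (Suc (Suc 0)) = (\<lambda>u. - 1 / (1 + u)^2)"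
    by (simp_all add: f_def fun_eq_iff)
  have S: "convex S" "0 \<in> S" "u \<in> S"
    using u by (auto simp: S_def convex_halfspace_Re_ge)
  have der: "(f i has_field_derivative f (Suc i) x) (at x within S)" if "x \<in> S" "i \<le> 1" for i x
  proof -
    have x: "Re x \<ge> 0" using that by (simp add: S_def)
    note nz = Re_nonneg_imp_one_plus(1,2)[OF x]
    consider "i = 0" | "i = Suc 0" using \<open>i \<le> 1\<close> by linarith
    thus ?thesis
    proof cases
      case 1
      show ?thesis unfolding 1 f0 f1 using nz
        by (auto intro!: derivative_eq_intros simp: inverse_eq_divide)
    next
      case 2
      show ?thesis unfolding 2 f1 f2 using nz
        by (auto intro!: derivative_eq_intros simp: divide_simps power2_eq_square)
    qed
  qed
  have bound: "cmod (f 1 x) \<le> 1" "cmod (f (Suc 1) x) \<le> 1" if "x \<in> S" for x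
    using Re_nonneg_imp_one_plus(2,3)[of x] that
    by (auto simp: f1 f2 S_def norm_divide norm_power divide_simps)
  have "cmod (f 0 u - (\<Sum>i\<le>0. f i 0 * (u - 0) ^ i / (fact i))) \<le> 1 * cmod (u - 0) ^ Suc 0 / fact 0"
    using S der bound by (intro complex_Taylor[where S = S]) auto
  thus "cmod (Ln (1 + u)) \<le> cmod u" by (simp add: f0)
  have "cmod (f 0 u - (\<Sum>i\<le>1. f i 0 * (u - 0) ^ i / (fact i))) \<le> 1 * cmod (u - 0) ^ Suc 1 / fact 1"
    using S der bound by (intro complex_Taylor[where S = S]) auto
  thus "cmod (Ln (1 + u) - u) \<le> cmod u ^ 2" by (simp add: f0 f1 power2_eq_square)
qed

text \<open>The product is split into z, a bounded multiple of a null sequence, and n (Ln (1 + z/n)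
  - z/n), which is O(1/n) by the second-order bound.\<close>

lemma tendsto_of_nat_Ln_one_plus:
  assumes z: "Re z \<ge> 0"
  shows "(\<lambda>n. (z + of_nat n + 1 / 2) * Ln (1 + z / of_nat n)) \<longlonglongrightarrow> z"
proof -
  have nonneg: "Re (z / of_nat n) \<ge> 0" for n using z by simp
  have "(\<lambda>n. Ln (1 + z / of_nat n)) \<longlonglongrightarrow> 0"
  proof (rule Lim_null_comparison[OF always_eventually])
    show "\<forall>n. cmod (Ln (1 + z / of_nat n)) \<le> cmod z / real n"
      using cmod_Ln_one_plus_le(1)[OF nonneg] by (auto simp: norm_divide)
    show "(\<lambda>n. cmod z / real n) \<longlonglongrightarrow> 0" by real_asymp
  qed
  hence A: "(\<lambda>n. (z + 1 / 2) * Ln (1 + z / of_nat n)) \<longlonglongrightarrow> 0"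
    by (rule tendsto_mult_right_zero)
  have "(\<lambda>n. of_nat n * (Ln (1 + z / of_nat n) - z / of_nat n)) \<longlonglongrightarrow> 0"
  proof (rule Lim_null_comparison[OF eventually_mono[OF eventually_gt_at_top[of 0]]])
    fix n :: nat assume n: "n > 0"
    have "cmod (of_nat n * (Ln (1 + z / of_nat n) - z / of_nat n)) \<le> n * (cmod (z / of_nat n) ^ 2)"
      unfolding norm_mult norm_of_nat by (intro mult_left_mono cmod_Ln_one_plus_le(2) nonneg) auto
    also have "\<dots> = cmod z ^ 2 / real n"
      using n by (simp add: norm_divide power2_eq_square field_simps)
    finally show "cmod (of_nat n * (Ln (1 + z / of_nat n) - z / of_nat n)) \<le> cmod z ^ 2 / real n" .
  next
    show "(\<lambda>n. cmod z ^ 2 / real n) \<longlonglongrightarrow> 0" by real_asymp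
  qed
  from tendsto_add[OF tendsto_add[OF A this] tendsto_const[of z]]
  have "(\<lambda>n. (z + 1 / 2) * Ln (1 + z / of_nat n) +
          of_nat n * (Ln (1 + z / of_nat n) - z / of_nat n) + z) \<longlonglongrightarrow> z" by simp
  moreover have "eventually (\<lambda>n. (z + 1 / 2) * Ln (1 + z / of_nat n) +
          of_nat n * (Ln (1 + z / of_nat n) - z / of_nat n) + z =
          (z + of_nat n + 1 / 2) * Ln (1 + z / of_nat n)) sequentially"
    using eventually_gt_at_top[of 0] by eventually_elim (simp add: algebra_simps)
  ultimately show ?thesis by (rule Lim_transform_eventually)
qed

text \<open>Obtained by solving \<open>ln_Gamma_series_eq_Stirling\<close> for its sequence free of
  \<open>z\<close>. The limit is therefore the same for all \<open>z\<close>, and it is the constant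
  in Stirling's formula.\<close>

lemma Stirling_fact_LIMSEQ:
  assumes "Re z > 0" "cmod z \<ge> 1"
  shows "(\<lambda>n. complex_of_real (ln (fact n) - (n + 1 / 2) * ln n + n)) \<longlonglongrightarrow>
           ln_Gamma z - (z - 1 / 2) * Ln z + z - Stirling_remainder z"
proof -
  have "z \<notin> \<int>\<^sub>\<le>\<^sub>0" using assms by (auto elim!: nonpos_Ints_cases)
  hence "ln_Gamma_series z \<longlonglongrightarrow> ln_Gamma z" by (rule ln_Gamma_complex_LIMSEQ)
  moreover have "(\<lambda>n. \<Sum>k<n. Stirling_term (z + of_nat k)) \<longlonglongrightarrow> Stirling_remainder z"
    using summable_LIMSEQ[OF summable_norm_cancel[OF summable_Stirling_term[OF assms]]]
    by (simp add: Stirling_remainder_def)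
  ultimately have "(\<lambda>n. ln_Gamma_series z n - (z - 1 / 2) * Ln z +
        (z + of_nat n + 1 / 2) * Ln (1 + z / of_nat n) - (\<Sum>k<n. Stirling_term (z + of_nat k)))
      \<longlonglongrightarrow> ln_Gamma z - (z - 1 / 2) * Ln z + z - Stirling_remainder z"
    using assms by (intro tendsto_intros tendsto_of_nat_Ln_one_plus) auto
  moreover have "eventually (\<lambda>n. ln_Gamma_series z n - (z - 1 / 2) * Ln z +
        (z + of_nat n + 1 / 2) * Ln (1 + z / of_nat n) - (\<Sum>k<n. Stirling_term (z + of_nat k)) =
        complex_of_real (ln (fact n) - (n + 1 / 2) * ln n + n)) sequentially"
    using eventually_gt_at_top[of 0]
    by eventually_elim (simp add: ln_Gamma_series_eq_Stirling[OF assms(1)])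
  ultimately show ?thesis by (rule Lim_transform_eventually)
qed

lemma Stirling_with_constant:
  "\<exists>K::real. \<forall>z. Re z > 0 \<longrightarrow> cmod z \<ge> 1 \<longrightarrow>
     ln_Gamma z = (z - 1 / 2) * Ln z - z + of_real K + Stirling_remainder z"
proof -
  define a where "a = (\<lambda>n::nat. ln (fact n) - (n + 1 / 2) * ln n + n)"
  \<comment> \<open>Evaluating at z = 1 shows that the sequence converges to a real number;
    uniqueness of limits then carries this value to every \<open>z\<close>.\<close>
  have "a \<longlonglongrightarrow> Re (ln_Gamma 1 - (1 - 1 / 2) * Ln 1 + 1 - Stirling_remainder 1)"
    using tendsto_Re[OF Stirling_fact_LIMSEQ[of 1]] by (simp add: a_def)
  then obtain K where K: "a \<longlonglongrightarrow> K" by blast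
  have "ln_Gamma z = (z - 1 / 2) * Ln z - z + of_real K + Stirling_remainder z"
    if z: "Re z > 0" "cmod z \<ge> 1" for z
  proof -
    have "(\<lambda>n. complex_of_real (a n)) \<longlonglongrightarrow> of_real K" using K by (rule tendsto_of_real)
    with Stirling_fact_LIMSEQ[OF z]
    have "ln_Gamma z - (z - 1 / 2) * Ln z + z - Stirling_remainder z = of_real K"
      unfolding a_def by (rule LIMSEQ_unique)
    thus ?thesis by (simp add: algebra_simps)
  qed
  thus ?thesis by blast
qed

section \<open>The constant in Stirling's formula\<close>

text \<open>Legendre's duplication formula is restricted to the positive reals, where
  \<open>Gamma\<close> is positive and taking logarithms raises no question of branches.\<close>

lemma ln_Gamma_duplication_real:
  fixes x :: real
  assumes "x > 0"
  shows "ln_Gamma x + ln_Gamma (x + 1 / 2) = (1 - 2 * x) * ln 2 + ln pi / 2 + ln_Gamma (2 * x)"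
proof -
  have "complex_of_real x \<notin> \<int>\<^sub>\<le>\<^sub>0" "complex_of_real x + 1 / 2 \<notin> \<int>\<^sub>\<le>\<^sub>0"
    using assms by (auto elim!: nonpos_Ints_cases simp: complex_eq_iff)
  from Gamma_legendre_duplication[OF this]
  have "complex_of_real (Gamma x * Gamma (x + 1 / 2)) =
          complex_of_real (exp ((1 - 2 * x) * ln 2) * sqrt pi * Gamma (2 * x))"
    by (simp flip: Gamma_complex_of_real exp_of_real)
  hence "Gamma x * Gamma (x + 1 / 2) = exp ((1 - 2 * x) * ln 2) * sqrt pi * Gamma (2 * x)"
    by (simp only: of_real_eq_iff)
  hence "ln (Gamma x * Gamma (x + 1 / 2)) = ln (exp ((1 - 2 * x) * ln 2) * sqrt pi * Gamma (2 * x))"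
    by simp
  also have "ln (Gamma x * Gamma (x + 1 / 2)) = ln_Gamma x + ln_Gamma (x + 1 / 2)"
    using assms by (simp add: ln_mult ln_Gamma_real_pos Gamma_real_pos less_imp_neq[symmetric])
  also have "ln (exp ((1 - 2 * x) * ln 2) * sqrt pi * Gamma (2 * x)) =
               (1 - 2 * x) * ln 2 + ln pi / 2 + ln_Gamma (2 * x)"
    using assms Gamma_real_pos[of "2 * x"]
    by (simp add: ln_mult ln_Gamma_real_pos ln_sqrt less_imp_neq[symmetric] del: Gamma_real_pos)
  finally show ?thesis .
qed

theorem Stirling_ln_Gamma:
  assumes "Re z > 0" "cmod z \<ge> 1"
  shows "ln_Gamma z = (z - 1 / 2) * Ln z - z + of_real (ln (2 * pi) / 2) + Stirling_remainder z"
proof -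
  obtain K :: real where K: "\<And>z. Re z > 0 \<Longrightarrow> cmod z \<ge> 1 \<Longrightarrow>
     ln_Gamma z = (z - 1 / 2) * Ln z - z + of_real K + Stirling_remainder z"
    using Stirling_with_constant by blast
  \<comment> \<open>The constant \<open>K\<close> is read off from Legendre's duplication formula as \<open>x\<close> tends to infinity.\<close>
  define g where "g = (\<lambda>x::real. ln_Gamma x - (x - 1 / 2) * ln x + x)"
  have "((\<lambda>x. g x - K) \<longlongrightarrow> 0) at_top"
  proof (rule Lim_null_comparison[OF eventually_mono[OF eventually_ge_at_top[of 1]]])
    fix x :: real assume x: "x \<ge> 1"
    have "complex_of_real (g x - K) = Stirling_remainder (of_real x)"
      using K[of "of_real x"] x by (simp add: g_def ln_Gamma_complex_of_real Ln_of_real)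
    hence "\<bar>g x - K\<bar> = cmod (Stirling_remainder (of_real x))" by (metis norm_of_real)
    also have "\<dots> \<le> 1 / x" using Stirling_remainder_bound[of "of_real x"] x by simp
    finally show "norm (g x - K) \<le> 1 / x" by simp
  next
    show "((\<lambda>x::real. 1 / x) \<longlongrightarrow> 0) at_top" by real_asymp
  qed
  hence g: "(g \<longlongrightarrow> K) at_top" by (simp add: LIM_zero_iff)
  have "((\<lambda>x. g x + g (x + 1 / 2) - g (2 * x)) \<longlongrightarrow> K + K - K) at_top"
    by (intro tendsto_intros g filterlim_compose[OF g]; real_asymp)
  moreover have "eventually (\<lambda>x. g x + g (x + 1 / 2) - g (2 * x) =
      (1 - 2 * x) * ln 2 + ln pi / 2 - (x - 1 / 2) * ln x - x * ln (x + 1 / 2) + 1 / 2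
        + (2 * x - 1 / 2) * ln (2 * x)) at_top"
    using eventually_gt_at_top[of 0]
    by eventually_elim (use ln_Gamma_duplication_real in \<open>simp add: g_def algebra_simps\<close>)
  ultimately have "((\<lambda>x::real. (1 - 2 * x) * ln 2 + ln pi / 2 - (x - 1 / 2) * ln x - x * ln (x + 1 / 2) + 1 / 2
        + (2 * x - 1 / 2) * ln (2 * x)) \<longlongrightarrow> K + K - K) at_top"
    by (rule Lim_transform_eventually)
  moreover have "((\<lambda>x::real. (1 - 2 * x) * ln 2 + ln pi / 2 - (x - 1 / 2) * ln x - x * ln (x + 1 / 2) + 1 / 2
        + (2 * x - 1 / 2) * ln (2 * x)) \<longlongrightarrow> ln (2 * pi) / 2) at_top"
  proof -
    \<comment> \<open>Once the logarithms are combined, \<open>x\<close> survives only in x ln (1 +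
      1/(2x)), which tends to 1/2.\<close>
    have "((\<lambda>x::real. ln (2 * pi) / 2 + (1 / 2 - x * ln (1 + 1 / (2 * x)))) \<longlongrightarrow> ln (2 * pi) / 2 + 0) at_top"
      by (intro tendsto_add tendsto_const; real_asymp)
    moreover have "eventually (\<lambda>x::real. ln (2 * pi) / 2 + (1 / 2 - x * ln (1 + 1 / (2 * x))) =
      (1 - 2 * x) * ln 2 + ln pi / 2 - (x - 1 / 2) * ln x - x * ln (x + 1 / 2) + 1 / 2
        + (2 * x - 1 / 2) * ln (2 * x)) at_top"
      using eventually_gt_at_top[of 0]
    proof eventually_elim
      case (elim x)
      have "1 + 1 / (2 * x) = (x + 1 / 2) / x" using elim by (simp add: field_simps)
      hence "ln (1 + 1 / (2 * x)) = ln (x + 1 / 2) - ln x" using elim by (simp add: ln_div)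
      moreover have "ln (2 * x) = ln 2 + ln x" "ln (2 * pi) = ln 2 + ln pi"
        using elim by (simp_all add: ln_mult)
      ultimately show ?case by (simp only: ring_distribs) (simp add: field_simps)
    qed
    ultimately have "((\<lambda>x::real. (1 - 2 * x) * ln 2 + ln pi / 2 - (x - 1 / 2) * ln x - x * ln (x + 1 / 2) + 1 / 2
        + (2 * x - 1 / 2) * ln (2 * x)) \<longlongrightarrow> ln (2 * pi) / 2 + 0) at_top"
      by (rule Lim_transform_eventually)
    thus ?thesis by simp
  qed
  ultimately have "K + K - K = ln (2 * pi) / 2"
    by (rule tendsto_unique[OF trivial_limit_at_top_linorder])
  hence "K = ln (2 * pi) / 2" by simp
  thus ?thesis using K[OF assms] by (simp only:)
qed

subsection \<open>Shifting the line of integration\<close>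

lemma integrable_abs_power_exp_neg_abs:
  fixes k :: real
  assumes "k > 0"
  shows "integrable lborel (\<lambda>x::real. \<bar>x\<bar> ^ m * exp (- k * \<bar>x\<bar>))"
proof -
  define h where "h = (\<lambda>x::real. x ^ m * exp (- x) * indicator {0<..} x)"
  have h: "integrable lborel h"
    using has_bochner_integral_I0i_power_exp_m[of m] unfolding h_def by (rule integrable.intros)
  moreover have "integrable lborel (\<lambda>x. h (- x))"
    using lborel_integrable_real_affine[OF h, of "-1" 0] by simp
  ultimately have "integrable lborel (\<lambda>x. h x + h (- x))" by simp
  \<comment> \<open>At 0 both halves of \<open>h\<close> vanish, whereas for m = 0 the function on
    the left is 1 there; the comparison thus holds only almost everywhere.\<close>
  hence "integrable lborel (\<lambda>x::real. \<bar>x\<bar> ^ m * exp (- \<bar>x\<bar>))"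
    by (rule Bochner_Integration.integrable_bound)
       (use AE_lborel_singleton[of "0::real"] in \<open>auto elim!: eventually_mono simp: h_def indicator_def abs_if\<close>)
  from lborel_integrable_real_affine[OF this, of k 0]
  have "integrable lborel (\<lambda>x::real. (\<bar>x\<bar> ^ m * exp (- k * \<bar>x\<bar>)) * k ^ m)"
    using assms by (simp add: abs_mult power_mult_distrib mult_ac)
  thus ?thesis using assms by (simp add: integrable_mult_left_iff del: mult_minus_left)
qed

lemma integral_vertical_line_shift:
  fixes f :: "complex \<Rightarrow> complex"
  assumes holo: "f holomorphic_on S" and S: "open S" "convex S"
    and strip: "\<And>z. p \<le> Re z \<Longrightarrow> Re z \<le> q \<Longrightarrow> z \<in> S"
    and pq: "p \<le> q" and k: "k > 0"
    and decay: "\<And>a x. p \<le> a \<Longrightarrow> a \<le> q \<Longrightarrow> cmod (f (Complex a x)) \<le> B * exp (- k * \<bar>x\<bar>)"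
  shows "(LBINT x. f (Complex p x)) = (LBINT x. f (Complex q x))"
proof -
  \<comment> \<open>With a primitive \<open>G\<close>, the two truncated integrals differ by increments of \<open>G\<close> along the horizontal
    edges of the rectangle, which the decay of \<open>f\<close> makes small.\<close>
  obtain G where G: "\<And>z. z \<in> S \<Longrightarrow> (G has_field_derivative f z) (at z)"
    using holomorphic_convex_primitive'[OF S(2,1) holo] at_within_open[OF _ S(1)] by metis
  have cont: "continuous_on A (\<lambda>x. f (Complex a x))" if "p \<le> a" "a \<le> q" for a A
    by (rule continuous_on_compose2[OF holomorphic_on_imp_continuous_on[OF holo]])
       (use that strip in \<open>auto intro!: continuous_intros simp: Complex_eq\<close>)
  have bound_int: "integrable lborel (\<lambda>x. B * exp (- k * \<bar>x\<bar>))"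
    using integrable_abs_power_exp_neg_abs[OF k, of 0]
    by (intro integrable_mult_right) (simp only: power_0 mult_1_left)
  have segment: "(\<integral>x. indicator {-T..T} x *\<^sub>R f (Complex a x) \<partial>lborel) =
      - \<i> * (G (Complex a T) - G (Complex a (- T)))" if "p \<le> a" "a \<le> q" "T \<ge> 0" for a T
  proof -
    \<comment> \<open>On a vertical line dz = i dx, so -i G is a primitive in the real
      parameter.\<close>
    have "((\<lambda>x. - \<i> * G (Complex a x)) has_vector_derivative f (Complex a x)) (at x within {-T..T})" for x
    proof -
      have "((\<lambda>x. G (Complex a x)) has_vector_derivative (\<i> * f (Complex a x))) (at x within {-T..T})"
      proof -
        have "(Complex a has_vector_derivative \<i>) (at x within {-T..T})"
          by (auto simp: Complex_eq[abs_def] intro!: derivative_eq_intros)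
        moreover have "(G has_field_derivative f (Complex a x)) (at (Complex a x) within Complex a ` {- T..T})"
          using that strip by (intro has_field_derivative_at_within[OF G]) auto
        ultimately show ?thesis
          by (rule field_vector_diff_chain_within[unfolded o_def])
      qed
      from has_vector_derivative_mult_right[OF this, of "- \<i>"] show ?thesis by simp
    qed
    from integral_FTC_atLeastAtMost[OF _ this cont] that show ?thesis by (simp add: algebra_simps)
  qed
  have horizontal: "cmod (G (Complex q T) - G (Complex p T)) \<le> B * exp (- k * \<bar>T\<bar>) * (q - p)" for T
  proof -
    have "cmod (G (Complex q T) - G (Complex p T)) \<le>
            B * exp (- k * \<bar>T\<bar>) * cmod (Complex q T - Complex p T)"
    proof (rule field_differentiable_bound)
      show "convex (closed_segment (Complex p T) (Complex q T))" by simp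
      fix z assume "z \<in> closed_segment (Complex p T) (Complex q T)"
      hence z: "p \<le> Re z" "Re z \<le> q" "Im z = T"
        using pq by (auto simp: closed_segment_same_Im closed_segment_eq_real_ivl)
      show "(G has_field_derivative f z) (at z within closed_segment (Complex p T) (Complex q T))"
        using z strip by (intro has_field_derivative_at_within[OF G]) auto
      show "cmod (f z) \<le> B * exp (- k * \<bar>T\<bar>)"
      proof -
        have "z = Complex (Re z) T" using z(3) by (simp add: complex_eq_iff)
        thus ?thesis using decay[OF z(1,2), of T] by metis
      qed
    qed auto
    also have "cmod (Complex q T - Complex p T) = q - p"
      using pq by (simp add: complex_diff cmod_def)
    finally show ?thesis .
  qed
  define I where "I = (\<lambda>a (n::nat). \<integral>x. indicator {-real n..real n} x *\<^sub>R f (Complex a x) \<partial>lborel)"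
  have lim: "I a \<longlonglongrightarrow> (LBINT x. f (Complex a x))" if a: "p \<le> a" "a \<le> q" for a
    unfolding I_def
  proof (rule integral_dominated_convergence[where w = "\<lambda>x. B * exp (- k * \<bar>x\<bar>)"])
    have "(\<lambda>x. f (Complex a x)) \<in> borel_measurable borel"
      using cont[OF a] by (rule borel_measurable_continuous_onI)
    thus "(\<lambda>x. f (Complex a x)) \<in> borel_measurable lborel"
      "\<And>n. (\<lambda>x. indicator {- real n..real n} x *\<^sub>R f (Complex a x)) \<in> borel_measurable lborel"
      by simp_all
    show "AE x in lborel. (\<lambda>n. indicator {- real n..real n} x *\<^sub>R f (Complex a x)) \<longlonglongrightarrow> f (Complex a x)"
    proof (rule AE_I2)
      fix x :: real
      have "eventually (\<lambda>n. indicator {- real n..real n} x *\<^sub>R f (Complex a x) = f (Complex a x)) sequentially"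
        using eventually_ge_at_top[of "nat \<lceil>\<bar>x\<bar>\<rceil>"] by eventually_elim (auto simp: indicator_def)
      thus "(\<lambda>n. indicator {- real n..real n} x *\<^sub>R f (Complex a x)) \<longlonglongrightarrow> f (Complex a x)"
        by (rule tendsto_eventually)
    qed
    show "AE x in lborel. norm (indicator {- real n..real n} x *\<^sub>R f (Complex a x)) \<le> B * exp (- k * \<bar>x\<bar>)" for n
      using decay[OF a] order_trans[OF norm_ge_zero decay[OF a]] by (intro AE_I2) (auto simp: indicator_def)
  qed (fact bound_int)
  have "(\<lambda>n. I q n - I p n) \<longlonglongrightarrow> 0"
  proof (rule Lim_null_comparison[OF always_eventually])
    \<comment> \<open>The factor 2 counts the top and the bottom edge of the rectangle.\<close>
    show "(\<lambda>n. 2 * (B * exp (- k * \<bar>real n\<bar>) * (q - p))) \<longlonglongrightarrow> 0"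
    proof -
      have "(\<lambda>n. exp (- k * \<bar>real n\<bar>)) \<longlonglongrightarrow> 0" using k by real_asymp
      hence "(\<lambda>n. 2 * (B * exp (- k * \<bar>real n\<bar>) * (q - p))) \<longlonglongrightarrow> 2 * (B * 0 * (q - p))"
        by (intro tendsto_mult tendsto_const)
      thus ?thesis by simp
    qed
    show "\<forall>n. norm (I q n - I p n) \<le> 2 * (B * exp (- k * \<bar>real n\<bar>) * (q - p))"
    proof
      fix n
      have "I q n - I p n = - \<i> * ((G (Complex q n) - G (Complex p n)) -
              (G (Complex q (- n)) - G (Complex p (- n))))"
        unfolding I_def using pq by (simp add: segment) (simp add: algebra_simps)
      also have "norm \<dots> \<le> cmod (G (Complex q n) - G (Complex p n)) +
              cmod (G (Complex q (- n)) - G (Complex p (- n)))"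
        by (simp add: norm_mult norm_triangle_ineq4)
      also have "\<dots> \<le> 2 * (B * exp (- k * \<bar>real n\<bar>) * (q - p))"
        using horizontal[of n] horizontal[of "- n"] by simp
      finally show "norm (I q n - I p n) \<le> 2 * (B * exp (- k * \<bar>real n\<bar>) * (q - p))" .
    qed
  qed
  moreover have "(\<lambda>n. I q n - I p n) \<longlonglongrightarrow> (LBINT x. f (Complex q x)) - (LBINT x. f (Complex p x))"
    using pq by (intro tendsto_diff lim) auto
  ultimately have "0 = (LBINT x. f (Complex q x)) - (LBINT x. f (Complex p x))"
    by (rule LIMSEQ_unique)
  thus ?thesis by simp
qed

section \<open>The phase on vertical lines and the decay of Gamma\<close>

text \<open>For z = a (1 + w) with a > 0 and Re w >= 0, the exponent z Ln z - z - z ln a exceeds its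
  value at z = a by \<open>a * saddle_phase w\<close>. The double zero at w = 0 is the
  saddle.\<close>

definition saddle_phase :: "complex \<Rightarrow> complex" where
  "saddle_phase w = (1 + w) * Ln (1 + w) - w"

lemma arctan_ge:
  assumes "v \<ge> (0::real)"
  shows "v / (1 + v) \<le> arctan v"
proof -
  have "arctan 0 - 0 / (1 + 0) \<le> arctan v - v / (1 + v)"
  proof (rule DERIV_nonneg_imp_nondecreasing[OF assms])
    fix x :: real assume x: "0 \<le> x" "x \<le> v"
    have "((\<lambda>v. arctan v - v / (1 + v)) has_real_derivative (inverse (1 + x\<^sup>2) - 1 / (1 + x)\<^sup>2)) (at x)"
      using x by (auto intro!: derivative_eq_intros simp: power2_eq_square)
    moreover have "1 / (1 + x)\<^sup>2 \<le> inverse (1 + x\<^sup>2)"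
      using x by (auto simp: inverse_eq_divide power2_eq_square algebra_simps intro!: divide_left_mono mult_pos_pos add_pos_nonneg)
    ultimately show "\<exists>y. ((\<lambda>v. arctan v - v / (1 + v)) has_real_derivative y) (at x) \<and> 0 \<le> y" by force
  qed
  thus ?thesis by simp
qed

text \<open>The bound behaves like v^2 near 0 and like v at infinity, covering both regimes at once.
  The derivative of v arctan v - ln (1 + v^2)/2 is arctan v, and that of v^2/(2 (1 + v)) is at most
  v/(1 + v), so \<open>arctan_ge\<close> applies.\<close>

lemma real_saddle_phase_bound:
  fixes v :: real
  assumes "v \<ge> 0"
  shows "ln (1 + v\<^sup>2) / 2 - v * arctan v \<le> - (v\<^sup>2 / (1 + v) / 2)"
proof -
  have "0 * arctan 0 - ln (1 + 0\<^sup>2) / 2 - 0\<^sup>2 / (1 + 0) / 2 \<le>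
          v * arctan v - ln (1 + v\<^sup>2) / 2 - v\<^sup>2 / (1 + v) / 2"
  proof (rule DERIV_nonneg_imp_nondecreasing[OF assms])
    fix x :: real assume x: "0 \<le> x" "x \<le> v"
    have pos: "1 + x\<^sup>2 > 0" "1 + x > 0" using x by (auto intro: add_pos_nonneg)
    have "((\<lambda>v. ln (1 + v\<^sup>2)) has_real_derivative inverse (1 + x\<^sup>2) * (2 * x)) (at x)"
      using pos by (auto intro!: derivative_eq_intros simp: inverse_eq_divide)
    moreover have "((\<lambda>v. v\<^sup>2 / (1 + v)) has_real_derivative
            (2 * x * (1 + x) - x\<^sup>2) / (1 + x)\<^sup>2) (at x)"
      using pos by (auto intro!: derivative_eq_intros simp: power2_eq_square)
    ultimately have "((\<lambda>v. v * arctan v - ln (1 + v\<^sup>2) / 2 - v\<^sup>2 / (1 + v) / 2) has_real_derivative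
            (1 * arctan x + inverse (1 + x\<^sup>2) * x - inverse (1 + x\<^sup>2) * (2 * x) / 2
              - (2 * x * (1 + x) - x\<^sup>2) / (1 + x)\<^sup>2 / 2)) (at x)"
      by (intro DERIV_diff DERIV_mult DERIV_cdivide DERIV_ident DERIV_arctan)
    moreover have "(2 * x * (1 + x) - x\<^sup>2) / (1 + x)\<^sup>2 / 2 \<le> x / (1 + x)"
    proof -
      have "(2 * x * (1 + x) - x\<^sup>2) / (1 + x)\<^sup>2 / 2 \<le> (2 * x * (1 + x)) / (1 + x)\<^sup>2 / 2"
        using x by (intro divide_right_mono) auto
      also have "(2 * x * w) / w\<^sup>2 / 2 = x / w" if "w > 0" for w
        using that by (simp add: power2_eq_square field_simps)
      hence "(2 * x * (1 + x)) / (1 + x)\<^sup>2 / 2 = x / (1 + x)" using pos(2) by blast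
      finally show ?thesis .
    qed
    ultimately show "\<exists>y. ((\<lambda>v. v * arctan v - ln (1 + v\<^sup>2) / 2 - v\<^sup>2 / (1 + v) / 2)
        has_real_derivative y) (at x) \<and> 0 \<le> y"
      using arctan_ge[OF x(1)] by (intro exI[of _ "1 * arctan x + inverse (1 + x\<^sup>2) * x -
        inverse (1 + x\<^sup>2) * (2 * x) / 2 - (2 * x * (1 + x) - x\<^sup>2) / (1 + x)\<^sup>2 / 2"] conjI) simp_all
  qed
  thus ?thesis by simp
qed

lemma Ln_one_plus_ii:
  fixes v :: real
  shows "Re (Ln (1 + \<i> * v)) = ln (1 + v\<^sup>2) / 2" "Im (Ln (1 + \<i> * v)) = arctan v"
proof -
  have nz: "1 + \<i> * v \<noteq> 0" by (simp add: complex_eq_iff)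
  have pos: "1 + v\<^sup>2 > 0" by (auto intro: add_pos_nonneg)
  have "cmod (1 + \<i> * v) = sqrt (1 + v\<^sup>2)" by (simp add: cmod_def)
  thus "Re (Ln (1 + \<i> * v)) = ln (1 + v\<^sup>2) / 2"
    using nz pos by (simp add: Re_Ln ln_sqrt)
  have "Im (Ln (1 + \<i> * v)) = Arg (1 + \<i> * v)" using nz by (simp add: Arg_eq_Im_Ln)
  also have "\<dots> = arctan v" by (subst arg_conv_arctan) auto
  finally show "Im (Ln (1 + \<i> * v)) = arctan v" .
qed

lemma Re_saddle_phase_bound:
  fixes v :: real
  shows "Re (saddle_phase (\<i> * v)) \<le> - (v\<^sup>2 / (1 + \<bar>v\<bar>) / 2)"
proof -
  have "Re (saddle_phase (\<i> * v)) = ln (1 + v\<^sup>2) / 2 - v * arctan v"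
    unfolding saddle_phase_def by (simp add: Ln_one_plus_ii)
  also have "\<dots> = ln (1 + \<bar>v\<bar>\<^sup>2) / 2 - \<bar>v\<bar> * arctan \<bar>v\<bar>"
    by (simp add: abs_if arctan_minus)
  also have "\<dots> \<le> - (\<bar>v\<bar>\<^sup>2 / (1 + \<bar>v\<bar>) / 2)"
    by (rule real_saddle_phase_bound) simp
  finally show ?thesis by simp
qed

text \<open>Sorted for estimates on the line Re z = a: a real constant, a purely imaginary
  oscillation that does not affect the modulus of the exponential, the phase, and lower-order terms.
  Any a >= 1 is allowed because the contour shift sweeps over a whole strip.\<close>

lemma ln_Gamma_saddle_form:
  fixes a v :: real
  assumes a: "a \<ge> 1"
  defines "z \<equiv> of_real a * (1 + \<i> * of_real v)"
  shows "ln_Gamma z = of_real ((a - 1 / 2) * ln a - a + ln (2 * pi) / 2) + \<i> * of_real (a * v * ln a)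
           + of_real a * saddle_phase (\<i> * of_real v) - Ln (1 + \<i> * of_real v) / 2 + Stirling_remainder z"
    and "cmod (Stirling_remainder z) \<le> 1 / a"
proof -
  have Re: "Re z = a" by (simp add: z_def)
  hence norm: "a \<le> cmod z" using complex_Re_le_cmod[of z] by simp
  have z: "Re z > 0" "cmod z \<ge> 1" using Re norm assms by auto
  have nz: "1 + \<i> * complex_of_real v \<noteq> 0" by (simp add: complex_eq_iff)
  have "Ln z = of_real (ln a) + Ln (1 + \<i> * of_real v)"
    unfolding z_def using a nz by (subst Ln_times_of_real) (auto simp: Ln_of_real)
  hence "(z - 1 / 2) * Ln z - z = of_real ((a - 1 / 2) * ln a - a) + \<i> * of_real (a * v * ln a)
           + of_real a * saddle_phase (\<i> * of_real v) - Ln (1 + \<i> * of_real v) / 2"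
    by (simp add: z_def saddle_phase_def algebra_simps)
  thus "ln_Gamma z = of_real ((a - 1 / 2) * ln a - a + ln (2 * pi) / 2) + \<i> * of_real (a * v * ln a)
           + of_real a * saddle_phase (\<i> * of_real v) - Ln (1 + \<i> * of_real v) / 2 + Stirling_remainder z"
    unfolding Stirling_ln_Gamma[OF z] by simp
  have "cmod (Stirling_remainder z) \<le> 1 / cmod z" by (rule Stirling_remainder_bound[OF z])
  also have "\<dots> \<le> 1 / a" using norm a z(2) by (intro divide_left_mono mult_pos_pos) auto
  finally show "cmod (Stirling_remainder z) \<le> 1 / a" .
qed

text \<open>Weakening the phase bound by v^2/(1 + |v|) >= |v| - 1 gives linear decay in |x| at a
  rate independent of \<open>a\<close>. The loss of a/2 is absorbed by the -a in Stirling's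
  formula.\<close>

lemma Re_ln_Gamma_bound:
  fixes a x :: real
  assumes a: "a \<ge> 1"
  shows "Re (ln_Gamma (Complex a x)) \<le> a * ln a + ln (2 * pi) / 2 + 1 - \<bar>x\<bar> / 2"
proof -
  define v where "v = x / a"
  define z where "z = complex_of_real a * (1 + \<i> * of_real v)"
  have z: "Complex a x = z" using a by (simp add: z_def v_def complex_eq_iff)
  have "Re (Stirling_remainder z) \<le> 1 / a"
    using ln_Gamma_saddle_form(2)[OF a, of v] complex_Re_le_cmod[of "Stirling_remainder z"]
    by (simp add: z_def)
  also have "\<dots> \<le> 1" using a by simp
  finally have R: "Re (Stirling_remainder z) \<le> 1" .
  have ax: "\<bar>x\<bar> = a * \<bar>v\<bar>" using a by (simp add: v_def abs_mult)
  define q where "q = v\<^sup>2 / (1 + \<bar>v\<bar>)"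
  have q: "\<bar>v\<bar> - 1 \<le> q" unfolding q_def
    by (subst pos_le_divide_eq) (auto simp: power2_eq_square algebra_simps abs_if)
  have "- (q / 2) \<le> (1 - \<bar>v\<bar>) / 2" using q by (simp add: field_simps)
  moreover have "Re (saddle_phase (\<i> * of_real v)) \<le> - (q / 2)"
    using Re_saddle_phase_bound[of v] by (simp add: q_def)
  ultimately have "Re (saddle_phase (\<i> * of_real v)) \<le> (1 - \<bar>v\<bar>) / 2"
    by (rule order_trans[rotated])
  hence "a * Re (saddle_phase (\<i> * of_real v)) \<le> a * ((1 - \<bar>v\<bar>) / 2)"
    using a by (intro mult_left_mono) auto
  hence phase: "a * Re (saddle_phase (\<i> * of_real v)) \<le> a / 2 - \<bar>x\<bar> / 2"
    by (simp add: ax algebra_simps)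
  have "Re (ln_Gamma z) = (a - 1 / 2) * ln a - a + ln (2 * pi) / 2
          + a * Re (saddle_phase (\<i> * of_real v)) - Re (Ln (1 + \<i> * of_real v)) / 2
          + Re (Stirling_remainder z)"
    unfolding z_def by (subst ln_Gamma_saddle_form(1)[OF a]) simp
  moreover have "Re (Ln (1 + \<i> * of_real v)) \<ge> 0" by (simp add: Ln_one_plus_ii)
  moreover have "(a - 1 / 2) * ln a \<le> a * ln a" using a by (intro mult_right_mono) auto
  ultimately show ?thesis unfolding z using R phase a by linarith
qed

text \<open>For 1 <= a <= s one has a ln a <= s ln s and a ln s >= 0, so one decay constant serves
  the whole strip. Its growth with \<open>s\<close> is harmless, since \<open>s\<close> is fixed
  during the shift.\<close>

lemma integral_Gamma_power_line_shift:
  fixes c s :: real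
  assumes "c > 0" "s \<ge> 1"
  defines "F \<equiv> (\<lambda>z. exp (of_real c * (ln_Gamma z - z * of_real (ln s))))"
  shows "(LBINT x. F (Complex 1 x)) = (LBINT x. F (Complex s x))"
proof (rule integral_vertical_line_shift[where S = "{z. Re z > 0}" and k = "c / 2"
        and B = "exp (c * (s * ln s + ln (2 * pi) / 2 + 1))"])
  show "F holomorphic_on {z. Re z > 0}"
    unfolding F_def by (intro holomorphic_intros) (auto simp: complex_nonpos_Reals_iff)
  show "open {z. Re z > 0}" "convex {z. Re z > 0}"
    by (auto simp: open_halfspace_Re_gt convex_halfspace_Re_gt)
  fix a x :: real assume a: "1 \<le> a" "a \<le> s"
  have "cmod (F (Complex a x)) = exp (c * (Re (ln_Gamma (Complex a x)) - a * ln s))"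
    by (simp add: F_def)
  also have "\<dots> \<le> exp (c * (s * ln s + ln (2 * pi) / 2 + 1 - \<bar>x\<bar> / 2))"
  proof -
    have "a * ln a \<le> s * ln s" using a by (intro mult_mono) auto
    moreover have "a * ln s \<ge> 0" using a by simp
    ultimately have "Re (ln_Gamma (Complex a x)) - a * ln s \<le> s * ln s + ln (2 * pi) / 2 + 1 - \<bar>x\<bar> / 2"
      using Re_ln_Gamma_bound[OF a(1), of x] by linarith
    thus ?thesis using assms by simp
  qed
  also have "\<dots> = exp (c * (s * ln s + ln (2 * pi) / 2 + 1)) * exp (- (c / 2) * \<bar>x\<bar>)"
    by (simp add: algebra_simps flip: exp_add)
  finally show "cmod (F (Complex a x)) \<le> exp (c * (s * ln s + ln (2 * pi) / 2 + 1)) * exp (- (c / 2) * \<bar>x\<bar>)" .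
qed (use assms in auto)

subsection \<open>Laplace's method at the saddle point\<close>

text \<open>All derivatives from the second on are multiples of powers of 1/(1 + u), bounded on the
  right half-plane. The cubic error controls the size of the exponent, the quartic one isolates its
  part of order \<open>1 / sqrt L\<close>.\<close>

lemma saddle_phase_Taylor:
  assumes u: "Re u \<ge> 0"
  shows "cmod (saddle_phase u - u\<^sup>2 / 2) \<le> cmod u ^ 3 / 2"
    and "cmod (saddle_phase u - (u\<^sup>2 / 2 - u ^ 3 / 6)) \<le> cmod u ^ 4 / 3"
proof -
  define S where "S = {z. Re z \<ge> 0}"
  define f :: "nat \<Rightarrow> complex \<Rightarrow> complex" where
    "f = (\<lambda>i u. if i = 0 then saddle_phase u else if i = 1 then Ln (1 + u)
       else if i = 2 then inverse (1 + u) else if i = 3 then - ((inverse (1 + u))^2)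
       else 2 * (inverse (1 + u))^3)"
  have f0: "f 0 = (\<lambda>u. (1 + u) * Ln (1 + u) - u)" and f1: "f (Suc 0) = (\<lambda>u. Ln (1 + u))"
    and f2: "f (Suc (Suc 0)) = (\<lambda>u. inverse (1 + u))"
    and f3: "f (Suc (Suc (Suc 0))) = (\<lambda>u. - ((inverse (1 + u))^2))"
    and f4: "f (Suc (Suc (Suc (Suc 0)))) = (\<lambda>u. 2 * (inverse (1 + u))^3)"
    by (simp_all add: f_def fun_eq_iff saddle_phase_def)
  have S: "convex S" "0 \<in> S" "u \<in> S"
    using u by (auto simp: S_def convex_halfspace_Re_ge)
  have der: "(f i has_field_derivative f (Suc i) x) (at x within S)" if "x \<in> S" "i \<le> 3" for i x
  proof -
    have x: "Re x \<ge> 0" using that by (simp add: S_def)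
    note nz = Re_nonneg_imp_one_plus(1,2)[OF x]
    consider "i = 0" | "i = Suc 0" | "i = Suc (Suc 0)" | "i = Suc (Suc (Suc 0))"
      using \<open>i \<le> 3\<close> by linarith
    thus ?thesis
    proof cases
      case 1
      have "(f 0 has_field_derivative Ln (1 + x) + inverse (1 + x) * (1 + x) - 1) (at x within S)"
        unfolding f0 using nz by (auto intro!: derivative_eq_intros)
      thus ?thesis using nz(2) unfolding 1 f1 by simp
    next
      case 2
      show ?thesis unfolding 2 f1 f2 using nz
        by (auto intro!: derivative_eq_intros)
    next
      case 3
      show ?thesis unfolding 3 f2 f3 using nz
        by (auto intro!: derivative_eq_intros simp: power2_eq_square)
    next
      case 4
      show ?thesis unfolding 4 f3 f4 using nz
        by (auto intro!: derivative_eq_intros simp: power2_eq_square power3_eq_cube)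
    qed
  qed
  have inv: "cmod (inverse (1 + x)) \<le> 1" if "x \<in> S" for x
    using Re_nonneg_imp_one_plus(2,3)[of x] that by (auto simp: S_def norm_inverse inverse_le_1_iff)
  have bound: "cmod (f (Suc 2) x) \<le> 1" "cmod (f (Suc 3) x) \<le> 2" if "x \<in> S" for x
    using power_le_one[OF norm_ge_zero inv[OF that], of 2] power_le_one[OF norm_ge_zero inv[OF that], of 3]
    by (auto simp: f_def norm_mult norm_power)
  have "cmod (f 0 u - (\<Sum>i\<le>2. f i 0 * (u - 0) ^ i / (fact i))) \<le> 1 * cmod (u - 0) ^ Suc 2 / fact 2"
    using S der bound(1) by (intro complex_Taylor[where S = S]) auto
  thus "cmod (saddle_phase u - u\<^sup>2 / 2) \<le> cmod u ^ 3 / 2"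
    by (simp add: f_def saddle_phase_def eval_nat_numeral)
  have "cmod (f 0 u - (\<Sum>i\<le>3. f i 0 * (u - 0) ^ i / (fact i))) \<le> 2 * cmod (u - 0) ^ Suc 3 / fact 3"
    using S der bound(2) by (intro complex_Taylor[where S = S]) auto
  also have "(\<Sum>i\<le>3. f i 0 * (u - 0) ^ i / (fact i)) = u\<^sup>2 / 2 - u ^ 3 / 6"
    by (simp add: f_def saddle_phase_def eval_nat_numeral)
  also have "2 * cmod (u - 0) ^ Suc 3 / fact 3 = cmod u ^ 4 / 3"
    by (simp add: eval_nat_numeral)
  finally show "cmod (saddle_phase u - (u\<^sup>2 / 2 - u ^ 3 / 6)) \<le> cmod u ^ 4 / 3"
    by (simp add: f_def)
qed

text \<open>Taylor's formula on the segment from 0 to \<open>w\<close>. Keeping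
  \<open>exp (Re w)\<close> explicit lets \<open>saddle_pointwise\<close> multiply the Gaussian into
  it before estimating.\<close>

lemma cmod_exp_minus_linear_le:
  "cmod (exp w - 1 - w) \<le> max 1 (exp (Re w)) * cmod w ^ 2"
proof -
  have "cmod (exp w - (\<Sum>i\<le>1. exp 0 * (w - 0) ^ i / (fact i)))
          \<le> max 1 (exp (Re w)) * cmod (w - 0) ^ Suc 1 / fact 1"
  proof (rule complex_Taylor[where S = "closed_segment 0 w" and f = "\<lambda>_. exp"])
    fix x assume "x \<in> closed_segment 0 w"
    then obtain r where r: "0 \<le> r" "r \<le> 1" "x = of_real r * w"
      by (auto simp: in_segment scaleR_conv_of_real)
    have "Re x \<le> max 0 (Re w)"
    proof (cases "Re w \<ge> 0")
      case True
      thus ?thesis using r mult_right_mono[of r 1 "Re w"] by simp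
    next
      case False
      thus ?thesis using r mult_nonneg_nonpos[of r "Re w"] by simp
    qed
    hence "exp (Re x) \<le> exp (max 0 (Re w))" by simp
    thus "cmod (exp x) \<le> max 1 (exp (Re w))" by (auto simp: max_def split: if_splits)
  qed (auto intro!: derivative_eq_intros)
  thus ?thesis by (simp add: power2_eq_square algebra_simps)
qed

text \<open>
  Collects the terms of order \<open>1 / sqrt L\<close>: the cubic Taylor term of \<^const>\<open>saddle_phase\<close> and the linear
  term of \<open>- c / 2 * Ln (1 + \<i> * v)\<close>, at \<open>v = y / sqrt L\<close>.
\<close>

definition saddle_linear :: "real \<Rightarrow> real \<Rightarrow> real \<Rightarrow> complex" where
  "saddle_linear c L y = \<i> * of_real ((y ^ 3 / 6 - c * y / 2) / sqrt L)"

text \<open>The first three summands bound L times the deviation of the exponent from its linear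
  part, and the square bounds L times the squared exponent. Nothing depends on \<open>s\<close>,
  which makes the estimate uniform.\<close>

definition saddle_majorant :: "real \<Rightarrow> real \<Rightarrow> real" where
  "saddle_majorant c y =
     exp (c + 1 / 2) * (\<bar>y\<bar> ^ 4 / 3 + c * \<bar>y\<bar> ^ 2 / 2 + c ^ 2 + (\<bar>y\<bar> ^ 3 / 2 + c * \<bar>y\<bar> / 2 + c ^ 2) ^ 2) * exp (- (\<bar>y\<bar> / 2))"

lemma integrable_saddle_majorant: "integrable lborel (saddle_majorant c)"
proof -
  have I: "integrable lborel (\<lambda>x::real. \<bar>x\<bar> ^ m * exp (- (1 / 2) * \<bar>x\<bar>))" for m
    by (rule integrable_abs_power_exp_neg_abs) simp
  \<comment> \<open>The coefficients come from expanding the square in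
    \<open>saddle_majorant\<close> by powers of |y|.\<close>
  have "integrable lborel (\<lambda>y. exp (c + 1 / 2) * (
      1 / 4 * (\<bar>y\<bar> ^ 6 * exp (- (1 / 2) * \<bar>y\<bar>)) + (1 / 3 + c / 2) * (\<bar>y\<bar> ^ 4 * exp (- (1 / 2) * \<bar>y\<bar>)) +
      c ^ 2 * (\<bar>y\<bar> ^ 3 * exp (- (1 / 2) * \<bar>y\<bar>)) + (c / 2 + c ^ 2 / 4) * (\<bar>y\<bar> ^ 2 * exp (- (1 / 2) * \<bar>y\<bar>)) +
      c ^ 3 * (\<bar>y\<bar> ^ 1 * exp (- (1 / 2) * \<bar>y\<bar>)) + (c ^ 2 + c ^ 4) * (\<bar>y\<bar> ^ 0 * exp (- (1 / 2) * \<bar>y\<bar>))))"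
    by (intro integrable_mult_right Bochner_Integration.integrable_add I)
  also have "(\<lambda>y. exp (c + 1 / 2) * (
      1 / 4 * (\<bar>y\<bar> ^ 6 * exp (- (1 / 2) * \<bar>y\<bar>)) + (1 / 3 + c / 2) * (\<bar>y\<bar> ^ 4 * exp (- (1 / 2) * \<bar>y\<bar>)) +
      c ^ 2 * (\<bar>y\<bar> ^ 3 * exp (- (1 / 2) * \<bar>y\<bar>)) + (c / 2 + c ^ 2 / 4) * (\<bar>y\<bar> ^ 2 * exp (- (1 / 2) * \<bar>y\<bar>)) +
      c ^ 3 * (\<bar>y\<bar> ^ 1 * exp (- (1 / 2) * \<bar>y\<bar>)) + (c ^ 2 + c ^ 4) * (\<bar>y\<bar> ^ 0 * exp (- (1 / 2) * \<bar>y\<bar>))))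
      = saddle_majorant c"
  proof
    fix y :: real
    define Y where "Y = \<bar>y\<bar>"
    define e where "e = exp (- (Y / 2))"
    have e: "exp (- (1 / 2) * Y) = e" by (simp add: e_def)
    show "exp (c + 1 / 2) * (
      1 / 4 * (\<bar>y\<bar> ^ 6 * exp (- (1 / 2) * \<bar>y\<bar>)) + (1 / 3 + c / 2) * (\<bar>y\<bar> ^ 4 * exp (- (1 / 2) * \<bar>y\<bar>)) +
      c ^ 2 * (\<bar>y\<bar> ^ 3 * exp (- (1 / 2) * \<bar>y\<bar>)) + (c / 2 + c ^ 2 / 4) * (\<bar>y\<bar> ^ 2 * exp (- (1 / 2) * \<bar>y\<bar>)) +
      c ^ 3 * (\<bar>y\<bar> ^ 1 * exp (- (1 / 2) * \<bar>y\<bar>)) + (c ^ 2 + c ^ 4) * (\<bar>y\<bar> ^ 0 * exp (- (1 / 2) * \<bar>y\<bar>)))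
      = saddle_majorant c y"
      unfolding saddle_majorant_def Y_def[symmetric] e e_def[symmetric]
      by (simp add: field_simps eval_nat_numeral)
  qed
  finally show ?thesis .
qed

text \<open>After the Gaussian is split off, the exponent is a small \<open>w\<close> with linear
  part \<open>l\<close>. Then exp w - 1 - l = (w - l) + (exp w - 1 - w), where the first bracket is
  O(1/L) and the second is quadratic in w = O(1/sqrt L).\<close>

lemma saddle_pointwise:
  fixes c s y :: real and R :: complex
  assumes c: "c > 0" and s: "s \<ge> 1" and lam: "c * s \<ge> 1" and R: "cmod R \<le> 1 / s"
  defines "L \<equiv> c * s"
  defines "v \<equiv> y / sqrt L"
  shows "cmod (exp (of_real L * saddle_phase (\<i> * of_real v) - of_real c * (Ln (1 + \<i> * of_real v) / 2) + of_real c * R)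
           - of_real (exp (- (y\<^sup>2 / 2))) * (1 + saddle_linear c L y)) \<le> saddle_majorant c y / L"
proof -
  define q where "q = sqrt L"
  have l1: "L \<ge> 1" using lam by (simp add: L_def)
  hence q: "q \<ge> 1" "q > 0" "q\<^sup>2 = L" by (auto simp: q_def)
  have v: "v = y / q" by (simp add: v_def q_def)
  have vy: "\<bar>v\<bar> \<le> \<bar>y\<bar>"
    using q divide_left_mono[of 1 q "\<bar>y\<bar>"] by (simp add: v abs_divide)
  have lv2: "L * v\<^sup>2 = y\<^sup>2" using q by (simp add: v power_divide flip: q(3))
  define u where "u = \<i> * complex_of_real v"
  have u: "Re u \<ge> 0" "cmod u = \<bar>v\<bar>" by (auto simp: u_def norm_mult)
  define w where "w = of_real L * saddle_phase u + of_real (y\<^sup>2 / 2) - of_real c * (Ln (1 + u) / 2) + of_real c * R"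
  define l where "l = saddle_linear c L y"
  have lu2: "of_real L * (u\<^sup>2 / 2) = - complex_of_real (y\<^sup>2 / 2)"
    by (simp add: u_def power_mult_distrib flip: lv2)
  have l_eq: "l = of_real L * (- (u ^ 3 / 6)) - of_real c * (u / 2)"
  proof -
    have "of_real L * (- (u ^ 3 / 6)) - of_real c * (u / 2) = \<i> * of_real (L * v ^ 3 / 6 - c * v / 2)"
      by (simp add: u_def power3_eq_cube algebra_simps)
    also have "L * v ^ 3 / 6 - c * v / 2 = (y ^ 3 / 6 - c * y / 2) / q"
      using q(2) by (simp add: v field_simps power_divide flip: q(3)) (simp add: power2_eq_square power3_eq_cube)
    finally show ?thesis by (simp add: l_def saddle_linear_def q_def)
  qed
  have cR: "cmod (of_real c * R) \<le> c\<^sup>2 / L"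
  proof -
    have "cmod (of_real c * R) \<le> c * (1 / s)"
      using c R unfolding norm_mult by (intro mult_mono) auto
    also have "\<dots> = c\<^sup>2 / L" using c s by (simp add: L_def power2_eq_square)
    finally show ?thesis .
  qed
  have wl: "cmod (w - l) \<le> (\<bar>y\<bar> ^ 4 / 3 + c * \<bar>y\<bar> ^ 2 / 2 + c ^ 2) / L"
  proof -
    have "w - l = of_real L * (saddle_phase u - (u\<^sup>2 / 2 - u ^ 3 / 6)) - of_real (c / 2) * (Ln (1 + u) - u) + of_real c * R"
      using lu2 unfolding w_def l_eq by (simp add: algebra_simps add_divide_distrib diff_divide_distrib)
    also have "cmod \<dots> \<le> cmod (of_real L * (saddle_phase u - (u\<^sup>2 / 2 - u ^ 3 / 6))) +
                cmod (of_real (c / 2) * (Ln (1 + u) - u)) + cmod (of_real c * R)"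
      by (intro norm_triangle_mono norm_triangle_ineq4 order_refl)
    also have "\<dots> \<le> L * (\<bar>v\<bar> ^ 4 / 3) + c / 2 * \<bar>v\<bar> ^ 2 + c\<^sup>2 / L"
      using saddle_phase_Taylor(2)[OF u(1)] cmod_Ln_one_plus_le(2)[OF u(1)] cR l1 c u(2)
      unfolding norm_mult by (intro add_mono mult_mono) auto
    also have "\<dots> = (\<bar>y\<bar> ^ 4 / 3 + c * \<bar>y\<bar> ^ 2 / 2 + c ^ 2) / L"
      using q(2) by (simp add: v power_divide abs_divide field_simps flip: q(3))
    finally show ?thesis .
  qed
  have w: "cmod w \<le> (\<bar>y\<bar> ^ 3 / 2 + c * \<bar>y\<bar> / 2 + c ^ 2) / q"
  proof -
    have "w = of_real L * (saddle_phase u - u\<^sup>2 / 2) - of_real (c / 2) * Ln (1 + u) + of_real c * R"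
      using lu2 unfolding w_def by (simp add: algebra_simps)
    also have "cmod \<dots> \<le> cmod (of_real L * (saddle_phase u - u\<^sup>2 / 2)) +
                cmod (of_real (c / 2) * Ln (1 + u)) + cmod (of_real c * R)"
      by (intro norm_triangle_mono norm_triangle_ineq4 order_refl)
    also have "\<dots> \<le> L * (\<bar>v\<bar> ^ 3 / 2) + c / 2 * \<bar>v\<bar> + c\<^sup>2 / q"
    proof -
      have "c\<^sup>2 / L \<le> c\<^sup>2 / q"
        using q mult_left_mono[of 1 q q] by (intro divide_left_mono mult_pos_pos) (auto simp: power2_eq_square simp flip: q(3))
      thus ?thesis
        using saddle_phase_Taylor(1)[OF u(1)] cmod_Ln_one_plus_le(1)[OF u(1)] cR l1 c u(2)
        unfolding norm_mult by (intro add_mono mult_mono) auto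
    qed
    also have "\<dots> = (\<bar>y\<bar> ^ 3 / 2 + c * \<bar>y\<bar> / 2 + c ^ 2) / q"
      using q(2) by (simp add: v power_divide abs_divide field_simps flip: q(3)) (simp add: eval_nat_numeral)
    finally show ?thesis .
  qed
  \<comment> \<open>A common bound for the Gaussian and for its product with
    \<open>exp (Re w)\<close>: the \<open>c\<close> in the exponent pays for the Stirling remainder,
    the 1/2 for the -1 in |y| - 1.\<close>
  define m where "m = exp (c + 1 / 2) * exp (- (\<bar>y\<bar> / 2))"
  have yq: "\<bar>y\<bar> - 1 \<le> y\<^sup>2 / (1 + \<bar>y\<bar>)"
    by (subst pos_le_divide_eq) (auto simp: power2_eq_square algebra_simps abs_if)
  have m1: "exp (- (y\<^sup>2 / 2)) \<le> m"
  proof -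
    have "2 * \<bar>y\<bar> * 1 \<le> \<bar>y\<bar>\<^sup>2 + 1\<^sup>2" by (rule sum_squares_bound)
    hence "- (y\<^sup>2 / 2) \<le> c + 1 / 2 + - (\<bar>y\<bar> / 2)" using c by simp
    thus ?thesis unfolding m_def exp_add[symmetric] by simp
  qed
  have m2: "exp (- (y\<^sup>2 / 2)) * exp (Re w) \<le> m"
  proof -
    \<comment> \<open>Since L >= 1 gives |v| <= |y|, the denominator 1 + |v| can be replaced by 1 +
      |y|, which removes the dependence on \<open>L\<close>.\<close>
    have "L * Re (saddle_phase u) \<le> L * (- (v\<^sup>2 / (1 + \<bar>v\<bar>) / 2))"
      unfolding u_def using l1 by (intro mult_left_mono Re_saddle_phase_bound) auto
    also have "\<dots> = - (y\<^sup>2 / (1 + \<bar>v\<bar>)) / 2" by (simp flip: lv2)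
    also have "\<dots> \<le> - (y\<^sup>2 / (1 + \<bar>y\<bar>)) / 2"
      using vy by (intro divide_right_mono le_imp_neg_le divide_left_mono mult_pos_pos) auto
    also have "- X / 2 \<le> 1 / 2 - \<bar>y\<bar> / 2" if "\<bar>y\<bar> - 1 \<le> X" for X
      using that by (simp add: field_simps)
    note this[OF yq]
    finally have A: "L * Re (saddle_phase u) \<le> 1 / 2 - \<bar>y\<bar> / 2" .
    have B: "Re (Ln (1 + u)) \<ge> 0" by (simp add: u_def Ln_one_plus_ii)
    have "c * Re R \<le> c * 1"
      using complex_Re_le_cmod[of R] R s c by (intro mult_left_mono) (auto elim!: order_trans)
    moreover have "c * (Re (Ln (1 + u)) / 2) \<ge> 0" using B c by simp
    ultimately have "- (y\<^sup>2 / 2) + Re w \<le> c + 1 / 2 + - (\<bar>y\<bar> / 2)"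
      using A by (simp add: w_def)
    thus ?thesis unfolding m_def exp_add[symmetric] by simp
  qed
  have "exp (of_real L * saddle_phase u - of_real c * (Ln (1 + u) / 2) + of_real c * R)
          = of_real (exp (- (y\<^sup>2 / 2))) * exp w"
    unfolding w_def exp_of_real[symmetric] by (simp flip: exp_add add: algebra_simps)
  hence "exp (of_real L * saddle_phase u - of_real c * (Ln (1 + u) / 2) + of_real c * R)
          - of_real (exp (- (y\<^sup>2 / 2))) * (1 + l) =
         of_real (exp (- (y\<^sup>2 / 2))) * ((w - l) + (exp w - 1 - w))"
    by (simp add: algebra_simps)
  also have "cmod \<dots> \<le> exp (- (y\<^sup>2 / 2)) * (cmod (w - l) + max 1 (exp (Re w)) * cmod w ^ 2)"
    unfolding norm_mult
    by (intro mult_mono order_trans[OF norm_triangle_ineq] add_mono cmod_exp_minus_linear_le) auto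
  also have "\<dots> = exp (- (y\<^sup>2 / 2)) * cmod (w - l) +
                    max (exp (- (y\<^sup>2 / 2))) (exp (- (y\<^sup>2 / 2)) * exp (Re w)) * cmod w ^ 2"
    by (simp add: algebra_simps max_mult_distrib_left max_mult_distrib_right)
  also have "\<dots> \<le> m * ((\<bar>y\<bar> ^ 4 / 3 + c * \<bar>y\<bar> ^ 2 / 2 + c ^ 2) / L) +
                      m * ((\<bar>y\<bar> ^ 3 / 2 + c * \<bar>y\<bar> / 2 + c ^ 2) / q) ^ 2"
    using m1 m2 by (intro add_mono mult_mono wl power_mono[OF w]) (auto simp: m_def)
  also have "\<dots> = saddle_majorant c y / L"
  proof -
    have "a * e * (X / L) + a * e * (Z / L) = a * (X + Z) * e / L" for a e X Z
      by (simp add: add_divide_distrib algebra_simps)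
    thus ?thesis unfolding saddle_majorant_def m_def power_divide q(3) .
  qed
  finally show ?thesis by (simp only: u_def l_def)
qed

text \<open>\<open>saddle_linear\<close> is an odd polynomial in \<open>y\<close>, so its Gaussian
  moments vanish and only the constant 1 contributes.\<close>

lemma gaussian_saddle_linear_integral:
  "has_bochner_integral lborel (\<lambda>y. of_real (exp (- (y\<^sup>2 / 2))) * (1 + saddle_linear c L y))
     (complex_of_real (sqrt (2 * pi)))"
proof -
  have gauss: "exp (- (y\<^sup>2 / 2)) = sqrt (2 * pi) * std_normal_density y" for y :: real
    by (simp add: std_normal_density_def)
  have 0: "has_bochner_integral lborel (\<lambda>y. complex_of_real (std_normal_density y)) 1"
  proof -
    have "has_bochner_integral lborel std_normal_density 1"
      using std_normal_moment_even[of 0] by simp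
    from has_bochner_integral_of_real[OF this] show ?thesis by simp
  qed
  have odd: "has_bochner_integral lborel (\<lambda>y. complex_of_real (std_normal_density y * y ^ (2 * k + 1))) 0" for k
    using std_normal_moment_odd[of k] has_bochner_integral_of_real by fastforce
  have "has_bochner_integral lborel (\<lambda>y. of_real (sqrt (2 * pi)) *
      (complex_of_real (std_normal_density y) +
        (\<i> / of_real (6 * sqrt L) * complex_of_real (std_normal_density y * y ^ (2 * 1 + 1)) -
         \<i> * of_real (c / (2 * sqrt L)) * complex_of_real (std_normal_density y * y ^ (2 * 0 + 1)))))
      (of_real (sqrt (2 * pi)) * (1 + (\<i> / of_real (6 * sqrt L) * 0 - \<i> * of_real (c / (2 * sqrt L)) * 0)))"
    by (intro has_bochner_integral_mult_right has_bochner_integral_add has_bochner_integral_diff 0 odd)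
  thus ?thesis
    by (simp add: gauss saddle_linear_def algebra_simps diff_divide_distrib power3_eq_cube)
qed

text \<open>The integrand at z = s with Stirling's remainder omitted; the terms s ln s have
  cancelled.\<close>

definition saddle_prefactor :: "real \<Rightarrow> real \<Rightarrow> real" where
  "saddle_prefactor c s = exp (c * (ln (2 * pi) / 2 - ln s / 2 - s))"

text \<open>On the line Re z = s the oscillation s v ln s of \<open>ln_Gamma\<close> cancels against
  the imaginary part of z ln s, leaving exactly the exponent of
  \<open>saddle_pointwise\<close>.\<close>

lemma Gamma_power_saddle_expansion:
  fixes c s y :: real
  assumes c: "c > 0" and s: "s \<ge> 1" and L: "c * s \<ge> 1"
  defines "F \<equiv> (\<lambda>z. exp (of_real c * (ln_Gamma z - z * of_real (ln s))))"
  shows "cmod (F (Complex s (s / sqrt (c * s) * y)) -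
           of_real (saddle_prefactor c s) * (of_real (exp (- (y\<^sup>2 / 2))) * (1 + saddle_linear c (c * s) y)))
         \<le> saddle_prefactor c s * (saddle_majorant c y / (c * s))"
proof -
  define v where "v = y / sqrt (c * s)"
  define z where "z = complex_of_real s * (1 + \<i> * of_real v)"
  define R where "R = Stirling_remainder z"
  define X where "X = of_real (c * s) * saddle_phase (\<i> * of_real v)
      - of_real c * (Ln (1 + \<i> * of_real v) / 2) + of_real c * R"
  define M where "M = complex_of_real (exp (- (y\<^sup>2 / 2))) * (1 + saddle_linear c (c * s) y)"
  have z: "Complex s (s / sqrt (c * s) * y) = z" by (simp add: z_def v_def complex_eq_iff)
  have "of_real c * (ln_Gamma z - z * of_real (ln s)) =
          complex_of_real (c * (ln (2 * pi) / 2 - ln s / 2 - s)) + X"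
    unfolding X_def z_def R_def
    by (subst ln_Gamma_saddle_form(1)[OF s]) (simp add: algebra_simps)
  hence "F z = of_real (saddle_prefactor c s) * exp X"
    by (simp add: F_def saddle_prefactor_def exp_add flip: exp_of_real)
  hence "F z - of_real (saddle_prefactor c s) * M = of_real (saddle_prefactor c s) * (exp X - M)"
    by (simp add: algebra_simps)
  also have "cmod \<dots> = saddle_prefactor c s * cmod (exp X - M)"
    by (simp add: norm_mult saddle_prefactor_def)
  also have "\<dots> \<le> saddle_prefactor c s * (saddle_majorant c y / (c * s))"
    unfolding X_def M_def v_def
    by (intro mult_left_mono saddle_pointwise c s L)
       (use ln_Gamma_saddle_form(2)[OF s, of v] in \<open>simp_all add: R_def z_def saddle_prefactor_def\<close>)
  finally show ?thesis unfolding z M_def .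
qed

lemma Gamma_power_saddle_integral:
  fixes c s :: real
  assumes c: "c > 0" and s: "s \<ge> 1" and L: "c * s \<ge> 1"
  defines "F \<equiv> (\<lambda>z. exp (of_real c * (ln_Gamma z - z * of_real (ln s))))"
  shows "cmod ((LBINT x. F (Complex s x)) - of_real (s / sqrt (c * s) * saddle_prefactor c s * sqrt (2 * pi)))
           \<le> s / sqrt (c * s) * saddle_prefactor c s * ((LBINT y. saddle_majorant c y) / (c * s))"
proof -
  define N where "N = s / sqrt (c * s)"
  define P where "P = saddle_prefactor c s"
  define G where "G = (\<lambda>y. F (Complex s (N * y)))"
  define M where "M = (\<lambda>y. of_real P * (of_real (exp (- (y\<^sup>2 / 2))) * (1 + saddle_linear c (c * s) y)))"
  have N: "N > 0" using s L by (simp add: N_def)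
  have P: "P > 0" by (simp add: P_def saddle_prefactor_def)
  have M: "has_bochner_integral lborel M (of_real P * of_real (sqrt (2 * pi)))"
    unfolding M_def by (intro has_bochner_integral_mult_right gaussian_saddle_linear_integral)
  have bound: "cmod (G y - M y) \<le> P * (saddle_majorant c y / (c * s))" for y
    unfolding G_def M_def N_def P_def F_def by (rule Gamma_power_saddle_expansion[OF c s L])
  have maj: "integrable lborel (\<lambda>y. P * (saddle_majorant c y / (c * s)))"
    using integrable_saddle_majorant[of c] by (intro integrable_mult_right integrable_divide_zero) simp
  have "continuous_on UNIV (\<lambda>y. ln_Gamma (Complex s (N * y)))"
  proof (rule continuous_on_compose2[where g = ln_Gamma and t = "{z. Re z > 0}"])
    show "continuous_on {z. Re z > 0} (ln_Gamma :: complex \<Rightarrow> complex)"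
      by (intro holomorphic_on_imp_continuous_on holomorphic_ln_Gamma) (auto simp: complex_nonpos_Reals_iff)
    show "continuous_on UNIV (\<lambda>y. Complex s (N * y))"
      unfolding Complex_eq by (intro continuous_intros)
  qed (use s in auto)
  hence "continuous_on UNIV G"
    unfolding G_def F_def Complex_eq by (intro continuous_intros)
  hence G_meas: "G \<in> borel_measurable lborel" by (simp add: borel_measurable_continuous_onI)
  have M_int: "integrable lborel M" using M by (rule integrable.intros)
  \<comment> \<open>The error bound itself yields integrability of \<open>G\<close>, as the sum of
    \<open>G - M\<close> and the integrable \<open>M\<close>.\<close>
  have diff: "integrable lborel (\<lambda>y. G y - M y)"
  proof (rule Bochner_Integration.integrable_bound[OF maj])
    show "(\<lambda>y. G y - M y) \<in> borel_measurable lborel"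
      using G_meas borel_measurable_integrable[OF M_int] by simp
    show "AE y in lborel. norm (G y - M y) \<le> norm (P * (saddle_majorant c y / (c * s)))"
      unfolding real_norm_def by (intro AE_I2 order_trans[OF bound abs_ge_self])
  qed
  have G_int: "integrable lborel G"
    using Bochner_Integration.integrable_add[OF diff M_int] by simp
  have "(LBINT x. F (Complex s x)) = of_real N * (LBINT y. G y)"
    using lborel_integral_real_affine[of N "\<lambda>x. F (Complex s x)" 0] N
    by (simp add: G_def scaleR_conv_of_real)
  hence "(LBINT x. F (Complex s x)) - of_real (N * P * sqrt (2 * pi)) =
           of_real N * ((LBINT y. G y) - (LBINT y. M y))"
    using has_bochner_integral_integral_eq[OF M] by (simp add: algebra_simps)
  also have "(LBINT y. G y) - (LBINT y. M y) = (LBINT y. G y - M y)"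
    by (rule Bochner_Integration.integral_diff[OF G_int M_int, symmetric])
  also have "cmod (of_real N * (LBINT y. G y - M y)) \<le> N * (LBINT y. P * (saddle_majorant c y / (c * s)))"
  proof -
    have "cmod (LBINT y. G y - M y) \<le> (LBINT y. P * (saddle_majorant c y / (c * s)))"
      by (rule Bochner_Integration.integral_norm_bound_integral[OF diff maj]) (rule bound)
    from mult_left_mono[OF this, of N] show ?thesis using N by (simp only: norm_mult norm_of_real abs_of_pos less_imp_le)
  qed
  also have "\<dots> = N * P * ((LBINT y. saddle_majorant c y) / (c * s))" by simp
  finally show ?thesis by (simp add: N_def P_def)
qed

section \<open>From the saddle integral to the density\<close>

text \<open>With t = s^c and z = 1 - ix the power of \<open>t\<close> is exp (-c z ln s). Reflecting
  \<open>x\<close> gives the line Re z = 1 its usual orientation before the contour is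
  moved.\<close>

lemma e_dens_eq_saddle_integral:
  fixes c s :: real
  assumes c: "c > 0" and s: "s \<ge> 1"
  shows "e_dens c (s powr c) =
    Re (LBINT x. exp (of_real c * (ln_Gamma (Complex s x) - Complex s x * of_real (ln s)))) / (2 * pi)"
proof -
  define F where "F = (\<lambda>z::complex. exp (of_real c * (ln_Gamma z - z * of_real (ln s))))"
  have "of_real (s powr c) powr (\<i> * of_real x - 1) * Gamma_powr (1 - \<i> * of_real x) c = F (Complex 1 (- x))" for x
  proof -
    have z: "Complex 1 (- x) = 1 - \<i> * of_real x" by (simp add: complex_eq_iff)
    have "s powr c > 0" using s by simp
    hence "complex_of_real (s powr c) powr (\<i> * of_real x - 1) =
            exp ((\<i> * of_real x - 1) * of_real (c * ln s))"
      using s by (simp add: powr_def Ln_of_real flip: exp_of_real)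
    thus ?thesis
      by (simp add: Gamma_powr_def F_def z algebra_simps flip: exp_add)
  qed
  hence "e_integral c (s powr c) = 1 / (2 * of_real pi) * (LBINT x. F (Complex 1 (- x)))"
    by (simp add: e_integral_def)
  also have "(LBINT x. F (Complex 1 (- x))) = (LBINT x. F (Complex 1 x))"
    using lborel_integral_real_affine[of "-1" "\<lambda>x. F (Complex 1 x)" 0] by simp
  also have "\<dots> = (LBINT x. F (Complex s x))"
    unfolding F_def by (rule integral_Gamma_power_line_shift[OF c s])
  also have "1 / (2 * of_real pi) * (LBINT x. F (Complex s x)) = of_real (1 / (2 * pi)) * (LBINT x. F (Complex s x))"
    by simp
  finally show ?thesis
    by (simp only: e_dens_def F_def Re_complex_of_real Im_complex_of_real times_complex.sel) simp
qed

lemma saddle_leading_term: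
  fixes c s :: real
  assumes c: "c > 0" and s: "s > 0"
  shows "s / sqrt (c * s) * saddle_prefactor c s * sqrt (2 * pi) / (2 * pi) =
    (2 * pi) powr ((c - 1) / 2) / sqrt c * (exp (- c * s) / s powr ((c - 1) / 2))"
proof -
  \<comment> \<open>In terms of these logarithms both sides are single exponentials, and the
    identity reduces to comparing exponents.\<close>
  define a b p where "a = ln s" and "b = ln c" and "p = ln (2 * pi)"
  have sqrt_eq: "sqrt x = exp (ln x / 2)" if "x > 0" for x
    using that by (simp add: powr_def flip: powr_half_sqrt)
  have cs: "ln (c * s) = ln c + ln s" using c s by (simp add: ln_mult_pos)
  have e: "exp a = s" "exp p = 2 * pi" "exp (b / 2) = sqrt c" "exp ((b + a) / 2) = sqrt (c * s)"
    "exp (p / 2) = sqrt (2 * pi)" "exp (c * (p / 2 - a / 2 - s)) = saddle_prefactor c s"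
    "exp ((c - 1) / 2 * p) = (2 * pi) powr ((c - 1) / 2)" "exp ((c - 1) / 2 * a) = s powr ((c - 1) / 2)"
    using c s cs by (simp_all add: a_def b_def p_def sqrt_eq saddle_prefactor_def powr_def)
  have "s / sqrt (c * s) * saddle_prefactor c s * sqrt (2 * pi) / (2 * pi) =
    exp (a - (b + a) / 2 + c * (p / 2 - a / 2 - s) + p / 2 - p)"
    by (simp only: exp_add exp_diff e)
  also have "a - (b + a) / 2 + c * (p / 2 - a / 2 - s) + p / 2 - p =
    (c - 1) / 2 * p - b / 2 + (- c * s - (c - 1) / 2 * a)"
    by (simp add: field_simps)
  also have "exp \<dots> = (2 * pi) powr ((c - 1) / 2) / sqrt c * (exp (- c * s) / s powr ((c - 1) / 2))"
    by (simp only: exp_add exp_diff e)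
  finally show ?thesis .
qed

theorem theorem2p1:
  fixes c :: real
  assumes "c > 0"
  shows "\<exists>r :: real \<Rightarrow> real.
           r \<in> O[at_top](\<lambda>t. 1 / t powr (1 / c)) \<and>
           (\<forall>\<^sub>F t in at_top.
              e_dens c t =
                (2 * pi) powr ((c - 1) / 2) / sqrt c *
                (exp (- c * t powr (1 / c)) / t powr ((c - 1) / (2 * c))) *
                (1 + r t))"
proof -
  define M where "M = (\<lambda>t. (2 * pi) powr ((c - 1) / 2) / sqrt c *
                (exp (- c * t powr (1 / c)) / t powr ((c - 1) / (2 * c))))"
  \<comment> \<open>The exact relative error: the required equation then holds for all t > 0, and
    only its size has to be estimated.\<close>
  define r where "r = (\<lambda>t. e_dens c t / M t - 1)"
  \<comment> \<open>The error \<open>A * (integral / (c * s))\<close> divided by the leading term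
    \<open>A * sqrt (2 * pi)\<close>, with 1/s taken out.\<close>
  define C where "C = (LBINT y. saddle_majorant c y) / (c * sqrt (2 * pi))"
  have M_pos: "M t > 0" if "t > 0" for t
    using that assms by (simp add: M_def)
  \<comment> \<open>The threshold max 1 (1/c) provides s >= 1 and c s >= 1, as
    \<open>Gamma_power_saddle_integral\<close> requires.\<close>
  have r_bound: "\<bar>r t\<bar> \<le> C * (1 / t powr (1 / c))" if t: "t > 0" "t powr (1 / c) \<ge> max 1 (1 / c)" for t
  proof -
    define s where "s = t powr (1 / c)"
    define J where "J = (LBINT x. exp (of_real c * (ln_Gamma (Complex s x) - Complex s x * of_real (ln s))))"
    define A where "A = s / sqrt (c * s) * saddle_prefactor c s"
    have s: "s \<ge> 1" "c * s \<ge> 1" using t assms by (auto simp: s_def field_simps)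
    have ts: "t = s powr c" using t assms by (simp add: s_def powr_powr)
    have t_powr: "t powr ((c - 1) / (2 * c)) = s powr ((c - 1) / 2)"
      by (simp add: s_def powr_powr mult.commute)
    have M_eq: "M t = A * sqrt (2 * pi) / (2 * pi)"
      unfolding M_def A_def t_powr s_def[symmetric]
      using assms s by (intro saddle_leading_term[symmetric]) auto
    have "e_dens c t - M t = Re (J - of_real (A * sqrt (2 * pi))) / (2 * pi)"
      using e_dens_eq_saddle_integral[OF assms s(1)] M_eq by (simp add: ts J_def diff_divide_distrib)
    hence "\<bar>e_dens c t - M t\<bar> = \<bar>Re (J - of_real (A * sqrt (2 * pi)))\<bar> / (2 * pi)"
      by (simp add: abs_divide)
    also have "\<dots> \<le> cmod (J - of_real (A * sqrt (2 * pi))) / (2 * pi)"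
      by (intro divide_right_mono abs_Re_le_cmod) simp
    also have "\<dots> \<le> A * ((LBINT y. saddle_majorant c y) / (c * s)) / (2 * pi)"
      unfolding J_def A_def
      by (intro divide_right_mono Gamma_power_saddle_integral[OF assms s]) simp
    also have "\<dots> = C * (1 / s) * M t"
      using assms s by (simp add: M_eq C_def)
    finally have "\<bar>e_dens c t - M t\<bar> / M t \<le> C * (1 / s)"
      using M_pos[OF t(1)] by (simp add: pos_divide_le_eq)
    moreover have "r t = (e_dens c t - M t) / M t"
      using M_pos[OF t(1)] by (simp add: r_def diff_divide_distrib)
    ultimately show ?thesis using M_pos[OF t(1)] by (simp add: s_def)
  qed
  have "filterlim (\<lambda>t::real. t powr (1 / c)) at_top at_top" using assms by real_asymp
  hence ev: "eventually (\<lambda>t. t powr (1 / c) \<ge> max 1 (1 / c)) at_top"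
    unfolding filterlim_at_top by blast
  show ?thesis
  proof (intro exI[of _ r] conjI)
    show "r \<in> O[at_top](\<lambda>t. 1 / t powr (1 / c))"
    proof (rule bigoI[of _ C])
      show "eventually (\<lambda>t. norm (r t) \<le> C * norm (1 / t powr (1 / c))) at_top"
        using ev eventually_gt_at_top[of 0] by eventually_elim (use r_bound in auto)
    qed
    show "eventually (\<lambda>t. e_dens c t = (2 * pi) powr ((c - 1) / 2) / sqrt c *
                (exp (- c * t powr (1 / c)) / t powr ((c - 1) / (2 * c))) * (1 + r t)) at_top"
      using eventually_gt_at_top[of 0]
    proof eventually_elim
      case (elim t)
      hence "e_dens c t = M t * (1 + r t)" using M_pos[of t] by (simp add: r_def)
      thus ?case by (simp only: M_def)
    qed
  qed
qed

end
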